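(* Let $n\ge 3$ and let $G=(V,E)$ be the complete undirected graph on $n$ nodes with edge costs $c(e)\in\{1,2\}$ for all $e\in E$. Then the cost of a minimum-cost tour (Hamiltonian cycle) in $G$ is at most $\frac{19}{15}$ times the optimal value of the subtour LP. That is, the integrality gap of the subtour LP for the 1,2-TSP is at most $\frac{19}{15}$.
   Context: The subtour LP for a complete graph $G=(V,E)$ with costs $c$ is: minimize $\sum_{e\in E} c(e)x(e)$ subject to $\sum_{e\in\delta(i)}x(e)=2$ for all $i\in V$; $\sum_{e\in\delta(S)}x(e)\ge 2$ for all $S\subset V$ with $3\le |S|\le |V|-3$; and $0\le x(e)\le 1$ for all $e\in E$. Here $\delta(S)$ denotes the set of edges with exactly one endpoint in $S$, and $\delta(i)=\delta(\{i\})$. *)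

theory Defs
  imports Complex_Main "HOL-Library.Extended_Real"
begin

text \<open>An undirected edge is the two-element set of its endpoints.\<close>

definition complete_edges :: "'a set \<Rightarrow> 'a set set" where
  "complete_edges V = {e. e \<subseteq> V \<and> card e = 2}"

definition cut_edges :: "'a set \<Rightarrow> 'a set \<Rightarrow> 'a set set" where
  "cut_edges V S = {e \<in> complete_edges V. card (e \<inter> S) = 1}"

definition edge_cost :: "('a set \<Rightarrow> real) \<Rightarrow> 'a set set \<Rightarrow> real" where
  "edge_cost c F = (\<Sum>e\<in>F. c e)"

text \<open>A Hamiltonian cycle is represented by its edge set. It arises from a cyclic ordering
  of all the nodes; having at least three nodes excludes degenerate closed walks.\<close>

definition cycle_edges :: "'a list \<Rightarrow> 'a set set" where
  "cycle_edges vs = {{vs ! i, vs ! (Suc i mod length vs)} | i. i < length vs}"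

definition hamiltonian_cycles :: "'a set \<Rightarrow> 'a set set set" where
  "hamiltonian_cycles V =
     {cycle_edges vs | vs. distinct vs \<and> set vs = V \<and> 3 \<le> length vs}"

definition min_tour_cost :: "'a set \<Rightarrow> ('a set \<Rightarrow> real) \<Rightarrow> real" where
  "min_tour_cost V c = Min (edge_cost c ` hamiltonian_cycles V)"

text \<open>The upper bound on the size of \<open>S\<close> is written additively, because subtraction on
  the natural numbers truncates. Values of \<open>x\<close> outside the edge set are irrelevant.\<close>

definition subtour_feasible :: "'a set \<Rightarrow> ('a set \<Rightarrow> real) \<Rightarrow> bool" where
  "subtour_feasible V x \<longleftrightarrow>
     (\<forall>i\<in>V. (\<Sum>e\<in>cut_edges V {i}. x e) = 2) \<and>
     (\<forall>S. S \<subset> V \<and> 3 \<le> card S \<and> card S + 3 \<le> card V \<longrightarrow>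
        (\<Sum>e\<in>cut_edges V S. x e) \<ge> 2) \<and>
     (\<forall>e\<in>complete_edges V. 0 \<le> x e \<and> x e \<le> 1)"

definition subtour_objective :: "'a set \<Rightarrow> ('a set \<Rightarrow> real) \<Rightarrow> ('a set \<Rightarrow> real) \<Rightarrow> real" where
  "subtour_objective V c x = (\<Sum>e\<in>complete_edges V. c e * x e)"

definition subtour_value :: "'a set \<Rightarrow> ('a set \<Rightarrow> real) \<Rightarrow> real" where
  "subtour_value V c = Inf (subtour_objective V c ` {x. subtour_feasible V x})"

definition one_two_costs :: "'a set \<Rightarrow> ('a set \<Rightarrow> real) \<Rightarrow> bool" where
  "one_two_costs V c \<longleftrightarrow> (\<forall>e\<in>complete_edges V. c e \<in> {1, 2})"

text \<open>The supremum ranges over instances of every size; node sets of natural numbers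
  represent all of them up to renaming of the nodes. It is taken in the extended reals so
  that it is meaningful without knowing in advance that the ratios are bounded.\<close>

definition subtour_integrality_gap_12 :: ereal where
  "subtour_integrality_gap_12 =
     Sup {ereal (min_tour_cost V c / subtour_value V c) | (V :: nat set) c.
            finite V \<and> 3 \<le> card V \<and> one_two_costs V c}"

text \<open>The following facts show that the minimum and the infimum above are taken over sets
  for which they are meaningful, and that the ratio has a positive denominator.\<close>

lemma finite_complete_edges: "finite V \<Longrightarrow> finite (complete_edges V)"
  unfolding complete_edges_def by (rule finite_subset[of _ "Pow V"]) auto

lemma finite_hamiltonian_cycles:
  assumes "finite V"
  shows "finite (hamiltonian_cycles V)"
proof (rule finite_subset)
  have "cycle_edges vs \<subseteq> Pow (set vs)" for vs :: "'a list"
  proof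
    fix e assume "e \<in> cycle_edges vs"
    then obtain i where "i < length vs" and e: "e = {vs ! i, vs ! (Suc i mod length vs)}"
      unfolding cycle_edges_def by blast
    then have "Suc i mod length vs < length vs" by (intro mod_less_divisor) linarith
    then show "e \<in> Pow (set vs)" using e \<open>i < length vs\<close> by auto
  qed
  then show "hamiltonian_cycles V \<subseteq> Pow (Pow V)"
    unfolding hamiltonian_cycles_def by blast
qed (use assms in simp)

lemma hamiltonian_cycles_nonempty:
  assumes "finite V" and "3 \<le> card V"
  shows "hamiltonian_cycles V \<noteq> {}"
proof -
  obtain vs where "set vs = V" "distinct vs"
    using finite_distinct_list[OF assms(1)] by blast
  then show ?thesis
    using assms(2) distinct_card[of vs] unfolding hamiltonian_cycles_def by auto
qed

lemma card_cut_edges: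
  assumes "finite V" and "S \<subseteq> V"
  shows "card (cut_edges V S) = card S * (card V - card S)"
proof -
  have "cut_edges V S = (\<lambda>(u, v). {u, v}) ` (S \<times> (V - S))"
  proof (intro equalityI subsetI)
    fix e assume "e \<in> cut_edges V S"
    then have e: "e \<subseteq> V" "card e = 2" "card (e \<inter> S) = 1"
      unfolding cut_edges_def complete_edges_def by auto
    then obtain u v where uv: "e = {u, v}" "u \<noteq> v" by (auto simp: card_2_iff)
    have "(u \<in> S \<and> v \<notin> S) \<or> (v \<in> S \<and> u \<notin> S)"
      using e(3) uv by (cases "u \<in> S"; cases "v \<in> S") auto
    then show "e \<in> (\<lambda>(u, v). {u, v}) ` (S \<times> (V - S))"
    proof
      assume "u \<in> S \<and> v \<notin> S"
      then have "(u, v) \<in> S \<times> (V - S)" using e(1) uv by auto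
      then show ?thesis by (rule rev_image_eqI) (use uv in auto)
    next
      assume "v \<in> S \<and> u \<notin> S"
      then have "(v, u) \<in> S \<times> (V - S)" using e(1) uv by auto
      then show ?thesis by (rule rev_image_eqI) (use uv in auto)
    qed
  next
    fix e assume "e \<in> (\<lambda>(u, v). {u, v}) ` (S \<times> (V - S))"
    then obtain u v where uv: "e = {u, v}" "u \<in> S" "v \<in> V" "v \<notin> S" by auto
    then have "u \<noteq> v" "e \<inter> S = {u}" by auto
    then show "e \<in> cut_edges V S"
      using uv assms(2) unfolding cut_edges_def complete_edges_def by auto
  qed
  moreover have "inj_on (\<lambda>(u, v). {u, v}) (S \<times> (V - S))"
    by (auto simp: inj_on_def doubleton_eq_iff)
  ultimately show ?thesis
    using assms by (simp add: card_image card_cartesian_product card_Diff_subset finite_subset)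
qed

lemma subtour_feasible_exists:
  assumes "finite V" and "3 \<le> card V"
  shows "\<exists>x. subtour_feasible V x"
proof
  define n where "n = card V"
  define x :: "'a set \<Rightarrow> real" where "x = (\<lambda>e. 2 / (real n - 1))"
  have n: "real n - 1 \<ge> 2" using assms(2) unfolding n_def by linarith
  have cut: "(\<Sum>e\<in>cut_edges V S. x e) = real (card S) * (real n - real (card S)) * (2 / (real n - 1))"
    if "S \<subseteq> V" for S
    using card_cut_edges[OF assms(1) that] card_mono[OF assms(1) that]
    by (simp add: x_def n_def of_nat_diff)
  show "subtour_feasible V x"
    unfolding subtour_feasible_def
  proof (intro conjI ballI allI impI)
    fix i assume "i \<in> V"
    then have "(\<Sum>e\<in>cut_edges V {i}. x e) = (real n - 1) * (2 / (real n - 1))"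
      using cut[of "{i}"] by simp
    moreover have "a * (2 / a) = 2" if "a \<noteq> 0" for a :: real using that by simp
    moreover have "real n - 1 \<noteq> 0" using n by linarith
    ultimately show "(\<Sum>e\<in>cut_edges V {i}. x e) = 2" by metis
  next
    fix S assume S: "S \<subset> V \<and> 3 \<le> card S \<and> card S + 3 \<le> card V"
    define s where "s = real (card S)"
    have s: "1 \<le> s" "s \<le> real n - 1" using S unfolding s_def n_def by linarith+
    have "0 \<le> (s - 1) * (real n - 1 - s)" using s by simp
    then have "real n - 1 \<le> s * (real n - s)" by (simp add: algebra_simps)
    then have "2 \<le> s * (real n - s) * (2 / (real n - 1))" using n by (simp add: field_simps)
    then show "2 \<le> (\<Sum>e\<in>cut_edges V S. x e)" using cut[of S] S unfolding s_def by auto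
  qed (use n in \<open>simp_all add: x_def\<close>)
qed

lemma sum_edges_eq_card:
  assumes "finite V" and "subtour_feasible V x"
  shows "(\<Sum>e\<in>complete_edges V. x e) = real (card V)"
proof -
  note fin = finite_complete_edges[OF assms(1)]
  have in_cut: "e \<in> cut_edges V {i} \<longleftrightarrow> i \<in> e" if "e \<in> complete_edges V" for e i
    using that unfolding cut_edges_def by (cases "i \<in> e") auto
  have "2 * real (card V) = (\<Sum>i\<in>V. \<Sum>e\<in>cut_edges V {i}. x e)"
    using assms(2) unfolding subtour_feasible_def by simp
  also have "\<dots> = (\<Sum>i\<in>V. \<Sum>e\<in>complete_edges V. if i \<in> e then x e else 0)"
  proof (rule sum.cong[OF refl])
    fix i
    have "cut_edges V {i} = {e \<in> complete_edges V. i \<in> e}"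
      using in_cut unfolding cut_edges_def by auto
    then show "(\<Sum>e\<in>cut_edges V {i}. x e) = (\<Sum>e\<in>complete_edges V. if i \<in> e then x e else 0)"
      using sum.inter_filter[OF fin, of x "\<lambda>e. i \<in> e"] by simp
  qed
  also have "\<dots> = (\<Sum>e\<in>complete_edges V. \<Sum>i\<in>V. if i \<in> e then x e else 0)"
    by (rule sum.swap)
  also have "\<dots> = (\<Sum>e\<in>complete_edges V. 2 * x e)"
  proof (rule sum.cong[OF refl])
    fix e assume "e \<in> complete_edges V"
    then have e: "card e = 2" "{i \<in> V. i \<in> e} = e" unfolding complete_edges_def by auto
    then show "(\<Sum>i\<in>V. if i \<in> e then x e else 0) = 2 * x e"
      using sum.inter_filter[OF assms(1), of "\<lambda>_. x e" "\<lambda>i. i \<in> e"] by simp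
  qed
  finally show ?thesis by (simp add: sum_distrib_left[symmetric])
qed

lemma subtour_objective_ge_card:
  assumes "finite V" and "one_two_costs V c" and "subtour_feasible V x"
  shows "real (card V) \<le> subtour_objective V c x"
proof -
  have "x e \<le> c e * x e" if "e \<in> complete_edges V" for e
  proof -
    have "0 \<le> x e" "c e = 1 \<or> c e = 2"
      using assms(2,3) that unfolding one_two_costs_def subtour_feasible_def by auto
    then show ?thesis by auto
  qed
  then have "(\<Sum>e\<in>complete_edges V. x e) \<le> subtour_objective V c x"
    unfolding subtour_objective_def by (intro sum_mono)
  then show ?thesis using sum_edges_eq_card[OF assms(1,3)] by simp
qed

lemma subtour_value_ge_card:
  assumes "finite V" and "3 \<le> card V" and "one_two_costs V c"
  shows "real (card V) \<le> subtour_value V c"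
  unfolding subtour_value_def
  using subtour_feasible_exists[OF assms(1,2)] subtour_objective_ge_card[OF assms(1,3)]
  by (intro cInf_greatest) auto

end

theory Submission
  imports Defs "HOL-Library.Disjoint_Sets"
begin

text \<open>
  Let \<open>G\<close> be the graph of the edges of cost 1 and let \<open>x\<close> be feasible with objective
  \<open>n + \<delta>\<close>, so that \<open>\<delta>\<close> is the total weight of the edges of cost 2. Summing the cut
  constraints over the components left by deleting a node set \<open>W\<close> shows that there are at most
  \<open>|W| + \<delta>\<close> of them. Adding \<open>t = \<lfloor>\<delta>\<rfloor>\<close> universal nodes makes \<open>G\<close> 1-tough, so everything
  reduces to covering a 1-tough graph on \<open>n \<ge> 4\<close> nodes by at most \<open>n/4\<close> paths.

  A 1-tough graph has a (near-)perfect matching. Contract its edges and take the Gallai--Edmonds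
  decomposition of the contracted graph: a set \<open>A\<close> whose removal leaves factor-critical blocks.
  By toughness and Hall's theorem the blocks can be attached to distinct nodes of \<open>\<Union>A\<close>. Hence a
  path is obtained for each member of \<open>A\<close>, while the remainder of every block splits into matched
  pairs of matching edges, which are paths on four nodes. Up to parity this gives \<open>n/4\<close> paths.
  In the exceptional cases all paths have exactly four nodes except for a leftover one with at most
  three nodes. The leftover path is absorbed by rematching the end nodes of the four-node paths to
  their middle nodes; where this is impossible Hall's condition fails, contradicting toughness.

  The resulting tour costs at most \<open>n + (n + t)/4 + t \<le> 5/4 (n + \<delta>)\<close>, which is stronger than required.
\<close>

section \<open>Matchings and the Gallai--Edmonds decomposition\<close>

lemma hall:
  fixes A :: "'i \<Rightarrow> 'b set"
  assumes "finite I" and "\<And>i. i \<in> I \<Longrightarrow> finite (A i)"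
    and "\<And>J. J \<subseteq> I \<Longrightarrow> card J \<le> card (\<Union>(A ` J))"
  shows "\<exists>f. inj_on f I \<and> (\<forall>i\<in>I. f i \<in> A i)"
  using assms
proof (induction "card I" arbitrary: I A rule: less_induct)
  case less
  note fin = less.prems(1,2) and cond = less.prems(3)
  show ?case
  \<comment> \<open>A nonempty proper subfamily \<open>J\<close> is tight when it has exactly
    \<open>card J\<close> values available. A tight \<open>J\<close> uses up its whole union, so
    \<open>J\<close> and \<open>I - J\<close> are treated separately by induction. Without tight
    subfamilies any one choice may be fixed.\<close>
  proof (cases "\<exists>J. J \<subset> I \<and> J \<noteq> {} \<and> card J = card (\<Union>(A ` J))")
    case True
    then obtain J where J: "J \<subset> I" "J \<noteq> {}" "card J = card (\<Union>(A ` J))" by blast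
    have finJ: "finite J" using J(1) fin(1) finite_subset by blast
    let ?U = "\<Union>(A ` J)"
    have finU: "finite ?U" using J(1) finJ fin(2) by blast
    have "\<exists>f. inj_on f J \<and> (\<forall>i\<in>J. f i \<in> A i)"
    proof (rule less.hyps)
      show "card J < card I" using psubset_card_mono[OF fin(1) J(1)] .
      show "card L \<le> card (\<Union>(A ` L))" if "L \<subseteq> J" for L
        using cond[of L] that J(1) by auto
    qed (use finJ fin(2) J(1) in auto)
    then obtain f where f: "inj_on f J" "\<forall>i\<in>J. f i \<in> A i" by blast
    have "\<exists>g. inj_on g (I - J) \<and> (\<forall>i\<in>I - J. g i \<in> A i - ?U)"
    proof (rule less.hyps)
      show "card (I - J) < card I"
        using J fin(1) by (intro psubset_card_mono) auto
      fix L assume L: "L \<subseteq> I - J"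
      have finL: "finite L" using L fin(1) finite_subset by blast
      have "card J + card L = card (J \<union> L)"
        using L finJ finL by (intro card_Un_disjoint[symmetric]) auto
      \<comment> \<open>Hall's condition for \<open>L\<close> without the values of \<open>J\<close>
        comes from the condition for \<open>J \<union> L\<close>, since \<open>J\<close> accounts
        for exactly \<open>card J\<close> of the values.\<close>
      also have "\<dots> \<le> card (\<Union>(A ` (J \<union> L)))"
        using cond[of "J \<union> L"] L J(1) by auto
      also have "\<Union>(A ` (J \<union> L)) = ?U \<union> \<Union>((\<lambda>i. A i - ?U) ` L)" by auto
      also have "card \<dots> = card ?U + card (\<Union>((\<lambda>i. A i - ?U) ` L))"
        using finU finL fin(2) L by (intro card_Un_disjoint) auto
      finally show "card L \<le> card (\<Union>((\<lambda>i. A i - ?U) ` L))" using J(3) by simp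
    qed (use fin in auto)
    then obtain g where g: "inj_on g (I - J)" "\<forall>i\<in>I - J. g i \<in> A i - ?U" by blast
    define h where "h i = (if i \<in> J then f i else g i)" for i
    have "f i \<noteq> g j" if "i \<in> J" "j \<in> I - J" for i j
      using f(2) g(2) that by fastforce
    then have "inj_on h I"
      using f(1) g(1) unfolding inj_on_def h_def by (metis DiffI)
    moreover have "\<forall>i\<in>I. h i \<in> A i" using f g by (auto simp: h_def)
    ultimately show ?thesis by blast
  next
    case no_tight: False
    show ?thesis
    proof (cases "I = {}")
      case False
      then obtain i where i: "i \<in> I" by blast
      then have "card {i} \<le> card (\<Union>(A ` {i}))" using cond[of "{i}"] by blast
      then have "A i \<noteq> {}" by auto
      then obtain a where a: "a \<in> A i" by blast
      have "\<exists>g. inj_on g (I - {i}) \<and> (\<forall>j\<in>I - {i}. g j \<in> A j - {a})"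
      proof (rule less.hyps)
        show "card (I - {i}) < card I" by (rule card_Diff1_less[OF fin(1) i])
        fix L assume L: "L \<subseteq> I - {i}"
        have finU: "finite (\<Union>(A ` L))" using L fin finite_subset[of L I] by blast
        show "card L \<le> card (\<Union>((\<lambda>j. A j - {a}) ` L))"
        proof (cases "L = {}")
          case False
          have "L \<subset> I" using L i by auto
          then have "card L \<noteq> card (\<Union>(A ` L))"
            using no_tight False by auto
          \<comment> \<open>As no nonempty proper subfamily is tight, there is a spare value, which
            pays for the removal of \<open>a\<close>.\<close>
          then have "card L < card (\<Union>(A ` L))"
            using cond[of L] \<open>L \<subset> I\<close> by auto
          moreover have "\<Union>((\<lambda>j. A j - {a}) ` L) = \<Union>(A ` L) - {a}" by auto
          moreover have "card (\<Union>(A ` L)) \<le> Suc (card (\<Union>(A ` L) - {a}))"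
            using finU by (metis card.insert_remove card_insert_le insert_Diff_single)
          ultimately show ?thesis by (metis less_Suc_eq_le order_less_le_trans)
        qed simp
      qed (use fin in auto)
      then obtain g where g: "inj_on g (I - {i})" "\<forall>j\<in>I - {i}. g j \<in> A j - {a}" by blast
      define h where "h j = (if j = i then a else g j)" for j
      have "a \<noteq> g j" if "j \<in> I - {i}" for j
        using g(2) that by fastforce
      then have "inj_on h I"
        using g(1) unfolding inj_on_def h_def by (metis DiffI singletonD)
      moreover have "\<forall>i\<in>I. h i \<in> A i" using g a by (auto simp: h_def)
      ultimately show ?thesis by blast
    qed simp
  qed
qed

section \<open>Matchings, factor-critical graphs and partitions into blocks\<close>

definition separated :: "('a \<Rightarrow> 'a \<Rightarrow> bool) \<Rightarrow> 'a set set \<Rightarrow> bool" where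
  "separated E \<K> \<longleftrightarrow> (\<forall>K\<in>\<K>. \<forall>L\<in>\<K>. K \<noteq> L \<longrightarrow> (\<forall>x\<in>K. \<forall>y\<in>L. \<not> E x y))"

definition perfect_matching :: "('a \<Rightarrow> 'a \<Rightarrow> bool) \<Rightarrow> 'a set \<Rightarrow> 'a set set \<Rightarrow> bool" where
  "perfect_matching E V M \<longleftrightarrow> partition_on V M \<and> (\<forall>B\<in>M. \<exists>x y. B = {x, y} \<and> x \<noteq> y \<and> E x y)"

definition matchable :: "('a \<Rightarrow> 'a \<Rightarrow> bool) \<Rightarrow> 'a set \<Rightarrow> bool" where
  "matchable E V \<longleftrightarrow> (\<exists>M. perfect_matching E V M)"

definition factor_critical :: "('a \<Rightarrow> 'a \<Rightarrow> bool) \<Rightarrow> 'a set \<Rightarrow> bool" where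
  "factor_critical E K \<longleftrightarrow> K \<noteq> {} \<and> (\<forall>v\<in>K. matchable E (K - {v}))"

lemma perfect_matchingE:
  assumes "perfect_matching E V M" "B \<in> M"
  obtains x y where "B = {x, y}" "x \<noteq> y" "E x y"
  using assms unfolding perfect_matching_def by metis

lemma matchable_empty [simp]: "matchable E {}"
  unfolding matchable_def perfect_matching_def by (rule exI[of _ "{}"]) (simp add: partition_on_def)

lemma matchable_pair: "x \<noteq> y \<Longrightarrow> E x y \<Longrightarrow> matchable E {x, y}"
  unfolding matchable_def perfect_matching_def
  by (rule exI[of _ "{{x, y}}"]) (auto simp: partition_on_def)

lemma partition_on_Un:
  assumes "partition_on V P" "partition_on W Q" "V \<inter> W = {}"
  shows "partition_on (V \<union> W) (P \<union> Q)"
proof (rule partition_onI)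
  have sub: "p \<subseteq> V" if "p \<in> P" for p using partition_onD1[OF assms(1)] that by auto
  have sub': "q \<subseteq> W" if "q \<in> Q" for q using partition_onD1[OF assms(2)] that by auto
  show "disjnt p q" if "p \<in> P \<union> Q" "q \<in> P \<union> Q" "p \<noteq> q" for p q
  proof -
    have mixed: "p \<inter> q = {}" if "p \<in> P" "q \<in> Q" for p q
      using sub[OF that(1)] sub'[OF that(2)] assms(3) by blast
    show ?thesis
      using that mixed[of p q] mixed[of q p] disjointD[OF partition_onD2[OF assms(1)], of p q]
        disjointD[OF partition_onD2[OF assms(2)], of p q]
      unfolding disjnt_def by (auto simp: Int_commute)
  qed
  show "\<Union>(P \<union> Q) = V \<union> W" using partition_onD1[OF assms(1)] partition_onD1[OF assms(2)] by simp
  show "{} \<notin> P \<union> Q" using partition_onD3[OF assms(1)] partition_onD3[OF assms(2)] by simp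
qed

lemma matchable_Un:
  assumes "matchable E V" "matchable E W" "V \<inter> W = {}"
  shows "matchable E (V \<union> W)"
proof -
  obtain M N where MN: "perfect_matching E V M" "perfect_matching E W N"
    using assms unfolding matchable_def by blast
  have "partition_on (V \<union> W) (M \<union> N)"
    using MN assms(3) unfolding perfect_matching_def by (intro partition_on_Un) blast+
  then have "perfect_matching E (V \<union> W) (M \<union> N)"
    using MN unfolding perfect_matching_def by blast
  then show ?thesis unfolding matchable_def by blast
qed

lemma matchable_UN:
  assumes "finite I" "\<And>i. i \<in> I \<Longrightarrow> matchable E (B i)" "disjoint_family_on B I"
  shows "matchable E (\<Union>i\<in>I. B i)"
  using assms
proof (induction I rule: finite_induct)
  case (insert i I)
  have "matchable E (\<Union>i\<in>I. B i)"
    using insert by (metis disjoint_family_on_mono insertCI subset_insertI)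
  moreover have "B i \<inter> (\<Union>i\<in>I. B i) = {}"
    using insert.prems(2) insert.hyps unfolding disjoint_family_on_def by fastforce
  ultimately show ?case using matchable_Un[of E "B i"] insert.prems(1) by simp
qed simp

lemma card_partition_on:
  assumes "finite V" "partition_on V \<K>"
  shows "card V = sum card \<K>"
proof -
  have "card (\<Union>\<K>) = sum card \<K>"
  proof (rule card_Union_disjoint)
    show "pairwise disjnt \<K>"
      using partition_onD2[OF assms(2)] by (auto simp: pairwise_def disjoint_def disjnt_def)
    show "finite K" if "K \<in> \<K>" for K
      using that assms partition_onD1 finite_subset[of K V] by blast
  qed
  then show ?thesis using partition_onD1[OF assms(2)] by simp
qed

lemma perfect_matching_card:
  assumes "finite V" "perfect_matching E V M"
  shows "card V = 2 * card M"
proof -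
  have "partition_on V M" and two: "\<And>B. B \<in> M \<Longrightarrow> card B = 2"
    using assms(2) unfolding perfect_matching_def by fastforce+
  then show ?thesis using card_partition_on[OF assms(1), of M] by simp
qed

lemma matchable_even: "finite V \<Longrightarrow> matchable E V \<Longrightarrow> even (card V)"
  unfolding matchable_def using perfect_matching_card by fastforce

lemma factor_critical_odd:
  assumes "finite K" "factor_critical E K" shows "odd (card K)"
proof -
  obtain v where v: "v \<in> K" "matchable E (K - {v})" using assms(2) unfolding factor_critical_def by blast
  then have "even (card (K - {v}))" using matchable_even[of "K - {v}" E] assms(1) by blast
  then show ?thesis using card_Suc_Diff1[OF assms(1) v(1)] by (metis even_Suc)
qed

definition odd_blocks :: "'a set set \<Rightarrow> nat" where
  "odd_blocks \<K> = card {K \<in> \<K>. odd (card K)}"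

lemma parity_partition:
  assumes "finite V" "partition_on V \<K>" "\<And>K. K \<in> \<K> \<Longrightarrow> odd (card K)"
  shows "even (card V) \<longleftrightarrow> even (card \<K>)"
proof -
  have "even (sum card \<K>) \<longleftrightarrow> even (card {K \<in> \<K>. odd (card K)})"
    using finite_elements[OF assms(1,2)] by (simp add: even_sum_iff)
  moreover have "{K \<in> \<K>. odd (card K)} = \<K>" using assms(3) by blast
  ultimately show ?thesis using card_partition_on[OF assms(1,2)] by simp
qed

lemma separatedD:
  "separated E \<K> \<Longrightarrow> K \<in> \<K> \<Longrightarrow> L \<in> \<K> \<Longrightarrow> K \<noteq> L \<Longrightarrow> x \<in> K \<Longrightarrow> y \<in> L \<Longrightarrow> \<not> E x y"
  unfolding separated_def by blast

lemma partition_on_remove: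
  assumes "partition_on V \<K>" "K \<in> \<K>"
  shows "partition_on (V - K) (\<K> - {K})"
proof (rule partition_onI)
  have disj: "L \<inter> K = {}" if "L \<in> \<K> - {K}" for L
    using disjointD[OF partition_onD2[OF assms(1)], of L K] that assms(2) by blast
  then show "\<Union>(\<K> - {K}) = V - K" using partition_onD1[OF assms(1)] by blast
  show "disjnt p q" if "p \<in> \<K> - {K}" "q \<in> \<K> - {K}" "p \<noteq> q" for p q
    using disjointD[OF partition_onD2[OF assms(1)], of p q] that unfolding disjnt_def by blast
  show "{} \<notin> \<K> - {K}" using partition_onD3[OF assms(1)] by blast
qed

lemma partition_on_refine:
  assumes "partition_on V \<K>" "K \<in> \<K>" "partition_on K' \<L>" "K' \<subseteq> K"
  shows "partition_on (V - (K - K')) ((\<K> - {K}) \<union> \<L>)"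
proof -
  have "partition_on ((V - K) \<union> K') ((\<K> - {K}) \<union> \<L>)"
    using assms(3,4) partition_on_remove[OF assms(1,2)] by (intro partition_on_Un) auto
  moreover have "(V - K) \<union> K' = V - (K - K')"
    using partition_onD1[OF assms(1)] assms(2,4) by blast
  ultimately show ?thesis by simp
qed

lemma separated_refine:
  assumes "separated E \<K>" "K \<in> \<K>" "separated E \<L>" "\<Union>\<L> \<subseteq> K"
  shows "separated E ((\<K> - {K}) \<union> \<L>)"
  unfolding separated_def
proof (intro ballI impI)
  fix P Q x y assume PQ: "P \<in> (\<K> - {K}) \<union> \<L>" "Q \<in> (\<K> - {K}) \<union> \<L>" "P \<noteq> Q" and xy: "x \<in> P" "y \<in> Q"
  have sub: "L \<subseteq> K" if "L \<in> \<L>" for L using that assms(4) by blast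
  consider "P \<in> \<K> - {K}" "Q \<in> \<K> - {K}" | "P \<in> \<K> - {K}" "Q \<in> \<L>" | "P \<in> \<L>" "Q \<in> \<K> - {K}" | "P \<in> \<L>" "Q \<in> \<L>"
    using PQ by blast
  then show "\<not> E x y"
  proof cases
    case 1 then show ?thesis using separatedD[OF assms(1), of P Q x y] PQ(3) xy by blast
  next
    case 2 then show ?thesis using separatedD[OF assms(1), of P K x y] assms(2) sub[of Q] xy by blast
  next
    case 3 then show ?thesis using separatedD[OF assms(1), of K Q x y] assms(2) sub[of P] xy by blast
  next
    case 4 then show ?thesis using separatedD[OF assms(3), of P Q x y] PQ(3) xy by blast
  qed
qed

text \<open>Each \<open>b\<close> takes a neighbour in its own block \<open>g b\<close>, and
  factor-criticality matches the rest of that block. Since \<open>g\<close> reaches every block,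
  nothing stays unmatched.\<close>

lemma matchable_decomposition:
  assumes "finite V" "B \<subseteq> V" "partition_on (V - B) \<L>"
    and crit: "\<And>L. L \<in> \<L> \<Longrightarrow> factor_critical E L"
    and g: "inj_on g B" "g ` B = \<L>" "\<And>b. b \<in> B \<Longrightarrow> \<exists>x\<in>g b. E b x"
  shows "matchable E V"
proof -
  obtain h where h: "\<And>b. b \<in> B \<Longrightarrow> h b \<in> g b \<and> E b (h b)" using g(3) by metis
  have gL: "g b \<in> \<L>" if "b \<in> B" for b using g(2) that by blast
  have disj: "g b \<inter> g c = {}" if "b \<in> B" "c \<in> B" "b \<noteq> c" for b c
    using disjointD[OF partition_onD2[OF assms(3)], of "g b" "g c"] gL that inj_onD[OF g(1)] by blast
  have outB: "g b \<inter> B = {}" if "b \<in> B" for b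
    using gL[OF that] partition_onD1[OF assms(3)] by blast
  have insert: "{b, h b} \<union> (g b - {h b}) = insert b (g b)" if "b \<in> B" for b
    using h[OF that] by blast
  have "matchable E (\<Union>b\<in>B. {b, h b} \<union> (g b - {h b}))"
  proof (rule matchable_UN)
    show "finite B" using assms(1,2) finite_subset by blast
    fix b assume b: "b \<in> B"
    have "b \<noteq> h b" using outB[OF b] h[OF b] b by (metis disjoint_iff)
    then have "matchable E {b, h b}" using h[OF b] by (simp add: matchable_pair)
    moreover have "matchable E (g b - {h b})"
      using crit[OF gL[OF b]] h[OF b] unfolding factor_critical_def by blast
    ultimately show "matchable E ({b, h b} \<union> (g b - {h b}))"
      using outB[OF b] b by (intro matchable_Un) auto
  next
    show "disjoint_family_on (\<lambda>b. {b, h b} \<union> (g b - {h b})) B"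
      unfolding disjoint_family_on_def
    proof (intro ballI impI)
      fix b c assume bc: "b \<in> B" "c \<in> B" "b \<noteq> c"
      then have "b \<notin> g c" "c \<notin> g b"
        using outB by (metis disjoint_iff)+
      then show "({b, h b} \<union> (g b - {h b})) \<inter> ({c, h c} \<union> (g c - {h c})) = {}"
        using disj[OF bc] bc insert by simp
    qed
  qed
  moreover have "(\<Union>b\<in>B. {b, h b} \<union> (g b - {h b})) = V"
  proof -
    have "(\<Union>b\<in>B. {b, h b} \<union> (g b - {h b})) = B \<union> \<Union>(g ` B)" using h by blast
    moreover have "B \<union> (V - B) = V" using assms(2) by blast
    ultimately show ?thesis using partition_onD1[OF assms(3)] g(2) by simp
  qed
  ultimately show ?thesis by simp
qed

text \<open>Gallai and Edmonds; see Theorem 2.2.3 of Diestel's Graph Theory.\<close>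

lemma factor_critical_decomposition:
  fixes E :: "'a \<Rightarrow> 'a \<Rightarrow> bool"
  assumes "finite V" and "symp E"
  obtains A \<K> g where "A \<subseteq> V" "partition_on (V - A) \<K>" "separated E \<K>"
    "\<And>K. K \<in> \<K> \<Longrightarrow> factor_critical E K"
    "inj_on g A" "\<And>a. a \<in> A \<Longrightarrow> g a \<in> \<K> \<and> (\<exists>x\<in>g a. E a x)"
proof -
  have "\<exists>A \<K> g. A \<subseteq> V \<and> partition_on (V - A) \<K> \<and> separated E \<K> \<and>
      (\<forall>K\<in>\<K>. factor_critical E K) \<and> inj_on g A \<and> (\<forall>a\<in>A. g a \<in> \<K> \<and> (\<exists>x\<in>g a. E a x))"
    using assms(1)
  \<comment> \<open>The hypothesis for smaller sets is applied to \<open>K - {v}\<close>, where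
    \<open>K\<close> is a block of an optimal pair, in order to show that \<open>K\<close> is
    factor-critical.\<close>
  proof (induction "card V" arbitrary: V rule: less_induct)
    case less
    note fin = less.prems
    define P where "P = {(A, \<K>). A \<subseteq> V \<and> partition_on (V - A) \<K> \<and> separated E \<K>}"
    \<comment> \<open>Encodes the lexicographic order: first the deficiency, then the size of \<open>A\<close>.\<close>
    define \<mu> :: "'a set \<times> 'a set set \<Rightarrow> int" where
      "\<mu> p = (int (card V) + 1) * (int (odd_blocks (snd p)) - int (card (fst p))) + int (card (fst p))" for p
    have finK: "finite \<K>" if "A \<subseteq> V" "partition_on (V - A) \<K>" for A \<K>
      using finite_elements[OF finite_Diff[OF fin] that(2)] .
    have "P \<subseteq> Pow V \<times> Pow (Pow V)"
      unfolding P_def using partition_onD1 by fastforce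
    then have finP: "finite P" by (rule finite_subset) (use fin in simp)
    have "(V, {}) \<in> P" by (simp add: P_def partition_on_empty separated_def)
    then have "Max (\<mu> ` P) \<in> \<mu> ` P" using finP by (intro Max_in) auto
    then obtain A \<K> where AK: "(A, \<K>) \<in> P" "\<mu> (A, \<K>) = Max (\<mu> ` P)" by fastforce
    then have A: "A \<subseteq> V" and part: "partition_on (V - A) \<K>" and sep: "separated E \<K>"
      by (auto simp: P_def)
    have fK: "finite \<K>" using finK[OF A part] .
    have optimal: "int (odd_blocks \<K>') - int (card A') < int (odd_blocks \<K>) - int (card A) \<or>
        int (odd_blocks \<K>') - int (card A') = int (odd_blocks \<K>) - int (card A) \<and> card A' \<le> card A"
      if "A' \<subseteq> V" "partition_on (V - A') \<K>'" "separated E \<K>'" for A' \<K>'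
    proof -
      have "\<mu> (A', \<K>') \<le> \<mu> (A, \<K>)"
        unfolding AK(2) using finP that by (intro Max_ge) (auto simp: P_def)
      moreover have "int (card A) \<le> int (card V)" using A fin by (simp add: card_mono)
      moreover define a b where "a = int (odd_blocks \<K>') - int (card A')"
        and "b = int (odd_blocks \<K>) - int (card A)"
      ultimately have *: "(int (card V) + 1) * a + int (card A') \<le> (int (card V) + 1) * b + int (card A)"
        "int (card A) \<le> int (card V)" by (simp_all add: \<mu>_def)
      \<comment> \<open>One unit of deficiency carries the weight \<open>card V + 1\<close>, which
        exceeds every possible \<open>card A\<close>, so the second component only breaks
        ties.\<close>
      have "a \<le> b"
      proof (rule ccontr)
        assume "\<not> a \<le> b"
        then have "(int (card V) + 1) * (b + 1) \<le> (int (card V) + 1) * a" by (intro mult_left_mono) auto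
        then show False using * by (simp add: algebra_simps)
      qed
      then show ?thesis using * unfolding a_def[symmetric] b_def[symmetric] by auto
    qed
    \<comment> \<open>Splitting a block further must lose deficiency, since it enlarges \<open>A\<close>.\<close>
    have no_gain: "int (odd_blocks (\<K> - {K})) + int (odd_blocks \<L>) < int (odd_blocks \<K>) + 1 + int (card B)"
      if K: "K \<in> \<K>" "v \<in> K" and B: "B \<subseteq> K - {v}" "partition_on (K - {v} - B) \<L>" "separated E \<L>"
      for K v B \<L>
    proof -
      have KV: "K \<subseteq> V - A" using partition_onD1[OF part] K(1) by blast
      have fB: "finite B" "finite A" using B(1) KV A fin by (meson finite_subset Diff_subset order_trans)+
      define A' where "A' = insert v (A \<union> B)"
      have "partition_on (V - A - (K - (K - {v} - B))) ((\<K> - {K}) \<union> \<L>)"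
        using part K(1) B(2) by (rule partition_on_refine) auto
      moreover have "V - A - (K - (K - {v} - B)) = V - A'"
        using KV K(2) B(1) unfolding A'_def by blast
      moreover have "separated E ((\<K> - {K}) \<union> \<L>)"
        using sep K(1) B(3) by (rule separated_refine) (use partition_onD1[OF B(2)] in blast)
      moreover have "A' \<subseteq> V" using A KV K(2) B(1) unfolding A'_def by blast
      ultimately have opt: "int (odd_blocks ((\<K> - {K}) \<union> \<L>)) - int (card A') < int (odd_blocks \<K>) - int (card A) \<or>
        int (odd_blocks ((\<K> - {K}) \<union> \<L>)) - int (card A') = int (odd_blocks \<K>) - int (card A) \<and> card A' \<le> card A"
        using optimal by simp
      have "v \<notin> A \<union> B" "A \<inter> B = {}" using KV K(2) B(1) by blast+
      then have cA': "card A' = card A + card B + 1"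
        using fB by (simp add: A'_def card_Un_disjoint)
      have "odd_blocks ((\<K> - {K}) \<union> \<L>) = odd_blocks (\<K> - {K}) + odd_blocks \<L>"
      proof -
        have "L \<notin> \<K> - {K}" if "L \<in> \<L>" for L
        proof
          assume L: "L \<in> \<K> - {K}"
          have "L \<subseteq> K" using that partition_onD1[OF B(2)] by blast
          moreover have "L \<inter> K = {}"
            using disjointD[OF partition_onD2[OF part], of L K] L K(1) by blast
          moreover have "L \<noteq> {}" using that partition_onD3[OF B(2)] by blast
          ultimately show False by blast
        qed
        then have "{K' \<in> \<K> - {K}. odd (card K')} \<inter> {K' \<in> \<L>. odd (card K')} = {}" by blast
        moreover have "finite \<L>"
          using finite_elements[OF _ B(2)] KV fin by (meson finite_subset finite_Diff)
        moreover have "{K' \<in> \<K> - {K} \<union> \<L>. odd (card K')} =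
          {K' \<in> \<K> - {K}. odd (card K')} \<union> {K' \<in> \<L>. odd (card K')}" by blast
        ultimately show ?thesis unfolding odd_blocks_def using fK by (simp add: card_Un_disjoint)
      qed
      then show ?thesis using opt cA' by linarith
    qed
    have ob_remove: "odd_blocks \<K> = odd_blocks (\<K> - {K}) + (if odd (card K) then 1 else 0)" if "K \<in> \<K>" for K
    proof (cases "odd (card K)")
      case True
      have "{K' \<in> \<K>. odd (card K')} = insert K {K' \<in> \<K> - {K}. odd (card K')}" using True that by blast
      then show ?thesis using fK True by (simp add: odd_blocks_def)
    next
      case False
      have "{K' \<in> \<K>. odd (card K')} = {K' \<in> \<K> - {K}. odd (card K')}" using False by blast
      then show ?thesis using False by (simp add: odd_blocks_def)
    qed
    \<comment> \<open>Moving a node \<open>v\<close> of an even block to \<open>A\<close> turns the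
      block into an odd one: the deficiency is kept and \<open>A\<close> grows, contrary to
      \<open>no_gain\<close> with empty \<open>B\<close>.\<close>
    have odd: "odd (card K)" if K: "K \<in> \<K>" for K
    proof (rule ccontr)
      assume even: "\<not> odd (card K)"
      have KV: "K \<subseteq> V - A" using partition_onD1[OF part] K by blast
      then have fK': "finite K" using fin by (meson finite_subset finite_Diff)
      have "K \<noteq> {}" using partition_onD3[OF part] K by blast
      then obtain v where v: "v \<in> K" by blast
      have "Suc (card (K - {v})) = card K" using card_Suc_Diff1[OF fK' v] .
      then have odd': "odd (card (K - {v}))" using even by (metis even_Suc)
      then have "K - {v} \<noteq> {}" by (metis card.empty even_zero)
      then have "partition_on (K - {v} - {}) {K - {v}}" by (simp add: partition_on_space)
      from no_gain[OF K v _ this] ob_remove[OF K] even odd'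
      show False by (simp add: odd_blocks_def separated_def)
    qed
    \<comment> \<open>Here \<open>l = card \<L>\<close>, \<open>b = card B\<close>,
      \<open>k = card (K - {v})\<close> and \<open>d = card (K - {v} - B)\<close>. All blocks in
      \<open>\<L>\<close> are odd and \<open>k\<close> is even, so \<open>l\<close> and
      \<open>b\<close> have the same parity; together with \<open>b \<le> l < b + 2\<close> this
      forces equality.\<close>
    have squeeze: "l < 2 + b \<Longrightarrow> (even d \<longleftrightarrow> even l) \<Longrightarrow> d = k - b \<Longrightarrow> b \<le> k \<Longrightarrow> even k \<Longrightarrow> b \<le> l \<Longrightarrow> l = b"
      for l b d k :: nat by presburger
    have crit: "factor_critical E K" if K: "K \<in> \<K>" for K
      unfolding factor_critical_def
    proof (intro conjI ballI)
      show "K \<noteq> {}" using partition_onD3[OF part] K by blast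
      fix v assume v: "v \<in> K"
      have KV: "K \<subseteq> V - A" using partition_onD1[OF part] K by blast
      then have fK': "finite K" using fin by (meson finite_subset finite_Diff)
      have cK: "Suc (card (K - {v})) = card K" using card_Suc_Diff1[OF fK' v] .
      moreover have "card K \<le> card V" using KV fin by (intro card_mono) auto
      ultimately have "card (K - {v}) < card V" by linarith
      from less.hyps[OF this] fK' obtain B \<L> g where B: "B \<subseteq> K - {v}" "partition_on (K - {v} - B) \<L>"
        "separated E \<L>" and Lc: "\<forall>L\<in>\<L>. factor_critical E L" and g: "inj_on g B"
        "\<forall>b\<in>B. g b \<in> \<L> \<and> (\<exists>x\<in>g b. E b x)"
        by blast
      have finL: "finite L" if "L \<in> \<L>" for L
        using that partition_onD1[OF B(2)] fK' by (metis Sup_upper finite_Diff finite_subset)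
      have fL: "finite \<L>" using finite_elements[OF _ B(2)] fK' by blast
      have fB: "finite B" using B(1) fK' by (meson finite_Diff finite_subset)
      have Lodd: "odd (card L)" if "L \<in> \<L>" for L using factor_critical_odd finL Lc that by blast
      have obL: "odd_blocks \<L> = card \<L>"
        using Lodd by (auto simp: odd_blocks_def intro!: arg_cong[of _ _ card])
      have "card \<L> < 2 + card B"
        using no_gain[OF K v B] ob_remove[OF K] odd[OF K] obL by simp
      moreover have "even (card (K - {v} - B)) \<longleftrightarrow> even (card \<L>)"
        by (rule parity_partition[OF _ B(2)]) (use fK' Lodd in auto)
      moreover have "card (K - {v} - B) = card (K - {v}) - card B" "card B \<le> card (K - {v})"
        using B(1) fB fK' by (auto intro: card_Diff_subset card_mono)
      moreover have "even (card (K - {v}))" using cK odd[OF K] by (metis even_Suc)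
      moreover have "card B \<le> card \<L>" using g fL by (intro card_inj_on_le[of g]) auto
      ultimately have card_eq: "card \<L> = card B" using squeeze by blast
      then have "g ` B = \<L>"
        using g fL by (intro card_subset_eq) (auto simp: card_image)
      then show "matchable E (K - {v})"
        using fK' B Lc g by (intro matchable_decomposition[of _ B \<L>]) auto
    qed
    \<comment> \<open>Hall's theorem assigns to the nodes of \<open>A\<close> distinct blocks
      adjacent to them.\<close>
    define N where "N a = {K \<in> \<K>. \<exists>x\<in>K. E a x}" for a
    have fA: "finite A" using A fin finite_subset by blast
    have "\<exists>g. inj_on g A \<and> (\<forall>a\<in>A. g a \<in> N a)"
    proof (rule hall)
      fix S assume S: "S \<subseteq> A"
      define NS where "NS = \<Union>(N ` S)"
      have NS: "NS \<subseteq> \<K>" unfolding NS_def N_def by blast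
      show "card S \<le> card (\<Union>(N ` S))"
      proof (rule ccontr)
        assume "\<not> card S \<le> card (\<Union>(N ` S))"
        then have less': "card NS < card S" by (simp add: NS_def)
        then have "S \<noteq> {}" by auto
        \<comment> \<open>If \<open>S\<close> has fewer than \<open>card S\<close> adjacent blocks,
          merging \<open>S\<close> and these blocks into one block \<open>R\<close> removes
          \<open>card S\<close> nodes from \<open>A\<close> but loses fewer odd blocks, so the
          deficiency would increase.\<close>
        define R where "R = S \<union> \<Union>NS"
        have blocks: "L \<subseteq> V - A" if "L \<in> \<K>" for L using that partition_onD1[OF part] by blast
        have RL: "L \<inter> R = {}" if "L \<in> \<K> - NS" for L
        proof -
          have "L \<inter> M = {}" if "M \<in> NS" for M
            using disjointD[OF partition_onD2[OF part], of L M] \<open>L \<in> \<K> - NS\<close> NS that by blast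
          then show ?thesis using blocks[of L] \<open>L \<in> \<K> - NS\<close> S unfolding R_def by blast
        qed
        have "partition_on (V - (A - S)) (insert R (\<K> - NS))"
        proof (rule partition_onI)
          show "\<Union>(insert R (\<K> - NS)) = V - (A - S)"
          proof -
            have "\<Union>(insert R (\<K> - NS)) = S \<union> \<Union>\<K>" using NS unfolding R_def by blast
            moreover have "S \<union> (V - A) = V - (A - S)" using S A by blast
            ultimately show ?thesis using partition_onD1[OF part] by simp
          qed
          show "{} \<notin> insert R (\<K> - NS)"
            using partition_onD3[OF part] \<open>S \<noteq> {}\<close> unfolding R_def by blast
          show "disjnt p q" if "p \<in> insert R (\<K> - NS)" "q \<in> insert R (\<K> - NS)" "p \<noteq> q" for p q
            using that RL[of p] RL[of q] disjointD[OF partition_onD2[OF part], of p q]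
            unfolding disjnt_def by (metis Diff_iff Int_commute insert_iff)
        qed
        moreover have "separated E (insert R (\<K> - NS))"
        proof -
          have RE: "\<not> E x y" if "x \<in> R" "y \<in> L" "L \<in> \<K> - NS" for x y L
            using that separatedD[OF sep, of _ L x y] NS unfolding R_def NS_def N_def by blast
          then have "\<not> E y x" if "x \<in> R" "y \<in> L" "L \<in> \<K> - NS" for x y L
            using that assms(2) by (meson sympD)
          then show ?thesis using RE separatedD[OF sep] unfolding separated_def by (metis Diff_iff insert_iff)
        qed
        moreover have "A - S \<subseteq> V" using A by blast
        ultimately have "int (odd_blocks (insert R (\<K> - NS))) - int (card (A - S)) \<le> int (odd_blocks \<K>) - int (card A)"
          using optimal[of "A - S" "insert R (\<K> - NS)"] by linarith
        moreover have "card (A - S) = card A - card S" "card S \<le> card A"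
          using S fA finite_subset[OF S fA] by (auto intro: card_Diff_subset card_mono)
        moreover have "odd_blocks (insert R (\<K> - NS)) \<ge> card (\<K> - NS)"
          unfolding odd_blocks_def using fK odd by (intro card_mono) auto
        moreover have "card (\<K> - NS) = card \<K> - card NS" "card NS \<le> card \<K>"
          using NS fK finite_subset[OF NS fK] by (auto intro: card_Diff_subset card_mono)
        moreover have "odd_blocks \<K> = card \<K>"
          using odd by (auto simp: odd_blocks_def intro!: arg_cong[of _ _ card])
        ultimately show False using less' by linarith
      qed
    qed (use fA fK in \<open>auto simp: N_def\<close>)
    then obtain g where "inj_on g A" "\<forall>a\<in>A. g a \<in> N a" by blast
    then have "inj_on g A \<and> (\<forall>a\<in>A. g a \<in> \<K> \<and> (\<exists>x\<in>g a. E a x))" unfolding N_def by blast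
    then show ?case using A part sep crit by (intro exI[of _ A] exI[of _ \<K>] exI[of _ g]) simp
  qed
  then show ?thesis using that by metis
qed

section \<open>Path covers of 1-tough graphs\<close>

definition is_path :: "('a \<Rightarrow> 'a \<Rightarrow> bool) \<Rightarrow> 'a list \<Rightarrow> bool" where
  "is_path E xs \<longleftrightarrow> distinct xs \<and> successively E xs"

inductive path_cover :: "('a \<Rightarrow> 'a \<Rightarrow> bool) \<Rightarrow> 'a set \<Rightarrow> nat \<Rightarrow> bool" for E where
  empty: "path_cover E {} 0"
| add_path: "path_cover E V k \<Longrightarrow> xs \<noteq> [] \<Longrightarrow> is_path E xs \<Longrightarrow> set xs \<inter> V = {} \<Longrightarrow>
    path_cover E (set xs \<union> V) (Suc k)"

text \<open>\<open>T\<close> is the tail hung on \<open>s\<close>, the last node of the longer path.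
  An empty \<open>T\<close> is attached to every node, so nodes without a tail fit the same
  pattern.\<close>

definition attached :: "('a \<Rightarrow> 'a \<Rightarrow> bool) \<Rightarrow> 'a set \<Rightarrow> 'a \<Rightarrow> bool" where
  "attached E T s \<longleftrightarrow> (\<exists>xs. is_path E (xs @ [s]) \<and> set xs = T)"

text \<open>For \<open>t = 0\<close> this is 1-toughness. The members of \<open>\<K>\<close> are unions of components of the
  graph without \<open>W\<close>; they need not cover it, which spares reasoning about components.\<close>

definition tough :: "('a \<Rightarrow> 'a \<Rightarrow> bool) \<Rightarrow> 'a set \<Rightarrow> nat \<Rightarrow> bool" where
  "tough E V t \<longleftrightarrow> (\<forall>W \<K>. W \<subseteq> V \<and> disjoint \<K> \<and>
     (\<forall>K\<in>\<K>. K \<noteq> {} \<and> K \<subset> V \<and> K \<inter> W = {} \<and> (\<forall>x\<in>K. \<forall>y\<in>V. E x y \<longrightarrow> y \<in> K \<union> W))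
     \<longrightarrow> card \<K> \<le> card W + t)"

lemma toughD:
  assumes "tough E V t" "W \<subseteq> V" "disjoint \<K>"
    and "\<And>K. K \<in> \<K> \<Longrightarrow> K \<noteq> {}" "\<And>K. K \<in> \<K> \<Longrightarrow> K \<subset> V" "\<And>K. K \<in> \<K> \<Longrightarrow> K \<inter> W = {}"
    and "\<And>K x y. K \<in> \<K> \<Longrightarrow> x \<in> K \<Longrightarrow> y \<in> V \<Longrightarrow> E x y \<Longrightarrow> y \<notin> W \<Longrightarrow> y \<in> K"
  shows "card \<K> \<le> card W + t"
proof -
  have "\<forall>K\<in>\<K>. K \<noteq> {} \<and> K \<subset> V \<and> K \<inter> W = {} \<and> (\<forall>x\<in>K. \<forall>y\<in>V. E x y \<longrightarrow> y \<in> K \<union> W)"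
    using assms(4-) by (metis UnCI)
  then show ?thesis using assms(1-3) unfolding tough_def by simp
qed

lemma is_path_rev: "symp E \<Longrightarrow> is_path E (rev xs) \<longleftrightarrow> is_path E xs"
  unfolding is_path_def successively_rev by (metis distinct_rev successively_mono sympD)

lemma is_path_append:
  "is_path E (xs @ ys) \<longleftrightarrow> is_path E xs \<and> is_path E ys \<and> set xs \<inter> set ys = {} \<and>
     (xs = [] \<or> ys = [] \<or> E (last xs) (hd ys))"
  unfolding is_path_def successively_append_iff by auto

lemma is_path_single [simp]: "is_path E [x]" "is_path E []"
  unfolding is_path_def by simp_all

lemma path_cover_one:
  assumes "is_path E xs" "xs \<noteq> []" shows "path_cover E (set xs) 1"
  using path_cover.add_path[OF path_cover.empty assms(2,1)] by simp

lemma path_cover_Un: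
  assumes "path_cover E V k" "path_cover E W l" "V \<inter> W = {}"
  shows "path_cover E (V \<union> W) (k + l)"
  using assms
proof (induction rule: path_cover.induct)
  case (add_path V k xs)
  then have "path_cover E (set xs \<union> (V \<union> W)) (Suc (k + l))"
    by (intro path_cover.add_path) auto
  then show ?case by (simp add: Un_assoc)
qed simp

lemma path_cover_UN:
  assumes "finite I" "\<And>i. i \<in> I \<Longrightarrow> path_cover E (B i) (k i)" "disjoint_family_on B I"
  shows "path_cover E (\<Union>i\<in>I. B i) (\<Sum>i\<in>I. k i)"
  using assms
proof (induction I rule: finite_induct)
  case empty
  then show ?case by (simp add: path_cover.empty)
next
  case (insert i I)
  have "path_cover E (\<Union>i\<in>I. B i) (\<Sum>i\<in>I. k i)"
    using insert by (metis disjoint_family_on_mono insertCI subset_insertI)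
  moreover have "B i \<inter> (\<Union>i\<in>I. B i) = {}"
    using insert.prems(2) insert.hyps unfolding disjoint_family_on_def by fastforce
  ultimately show ?case using path_cover_Un[of E "B i" "k i"] insert.prems(1) insert.hyps by simp
qed

text \<open>Each member of \<open>C\<close> yields one path: a pair \<open>{x, y}\<close> becomes
  the middle edge between the tails of \<open>x\<close> and \<open>y\<close>, while a single node
  just ends its tail. The number of paths thus depends on the middles alone, and tails can be
  redistributed freely.\<close>

lemma path_cover_attached:
  assumes "symp E" "finite S" "partition_on S C"
    and C: "\<And>B. B \<in> C \<Longrightarrow> \<exists>x y. B = {x, y} \<and> (x = y \<or> E x y)"
    and T: "\<And>s. s \<in> S \<Longrightarrow> attached E (T s) s" "disjoint_family_on T S"
    and TS: "\<And>s. s \<in> S \<Longrightarrow> T s \<inter> S = {}"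
  shows "path_cover E (S \<union> \<Union>(T ` S)) (card C)"
proof -
  have SC: "S = \<Union>C" using assms(3) by (rule partition_onD1)
  have "path_cover E (\<Union>B\<in>C. B \<union> \<Union>(T ` B)) (\<Sum>B\<in>C. 1)"
  proof (rule path_cover_UN)
    show "finite C" using finite_elements assms(2,3) by blast
    fix B assume B: "B \<in> C"
    then have BS: "B \<subseteq> S" using SC by blast
    from C[OF B] obtain x y where xy: "B = {x, y}" "x = y \<or> E x y" by blast
    have in_S: "x \<in> S" "y \<in> S" using xy BS by auto
    obtain xs where xs: "is_path E (xs @ [x])" "set xs = T x"
      using T(1)[OF in_S(1)] unfolding attached_def by blast
    obtain ys where ys: "is_path E (ys @ [y])" "set ys = T y"
      using T(1)[OF in_S(2)] unfolding attached_def by blast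
    show "path_cover E (B \<union> \<Union>(T ` B)) 1"
    proof (cases "x = y")
      case True
      then show ?thesis using path_cover_one[OF xs(1)] xs(2) xy(1) by simp
    next
      case False
      have "is_path E (y # rev ys)" using ys(1) is_path_rev[OF assms(1), of "ys @ [y]"] by simp
      moreover have "T x \<inter> T y = {}"
        using disjoint_family_onD[OF T(2) in_S False] .
      ultimately have "is_path E ((xs @ [x]) @ (y # rev ys))"
        using xs ys False xy(2) TS[OF in_S(1)] TS[OF in_S(2)] in_S
        by (subst is_path_append) auto
      from path_cover_one[OF this] show ?thesis using xs(2) ys(2) xy(1)
        by (simp add: insert_commute Un_assoc Un_left_commute)
    qed
  next
    show "disjoint_family_on (\<lambda>B. B \<union> \<Union>(T ` B)) C"
      unfolding disjoint_family_on_def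
    proof (intro ballI impI)
      fix B B' assume B: "B \<in> C" "B' \<in> C" "B \<noteq> B'"
      then have sub: "B \<subseteq> S" "B' \<subseteq> S" using SC by blast+
      have disj: "B \<inter> B' = {}" using disjointD[OF partition_onD2[OF assms(3)] B] .
      have "T s \<inter> T s' = {}" if "s \<in> B" "s' \<in> B'" for s s'
        using disjoint_family_onD[OF T(2), of s s'] that sub disj by blast
      then have "\<Union>(T ` B) \<inter> \<Union>(T ` B') = {}" by blast
      moreover have "B \<inter> \<Union>(T ` B') = {}" "\<Union>(T ` B) \<inter> B' = {}" using TS sub by blast+
      ultimately show "(B \<union> \<Union>(T ` B)) \<inter> (B' \<union> \<Union>(T ` B')) = {}"
        using disj by (simp add: Int_Un_distrib Int_Un_distrib2)
    qed
  qed
  moreover have "(\<Union>B\<in>C. B \<union> \<Union>(T ` B)) = S \<union> \<Union>(T ` S)" unfolding SC by blast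
  ultimately show ?thesis by simp
qed

text \<open>The matching \<open>C\<close> consists of the middle edges of four-node paths with end nodes
  \<open>e ` S\<close>, and \<open>Q\<close> carries the leftover path. The nodes in \<open>P\<close> can serve as ends of a
  Hamiltonian path of \<open>Q\<close>. A minimal family \<open>\<D>\<close> of end pieces violating Hall's condition contains
  \<open>Q\<close>, and each of its members can be made the leftover piece, so an edge between it and another end
  piece joins the two.\<close>

lemma absorb_leftover:
  assumes "symp E" "finite V" and tough: "tough E V 0"
    and C: "perfect_matching E S C" and "S \<noteq> {}"
    and e: "inj_on e S" "\<And>s. s \<in> S \<Longrightarrow> e s \<notin> S" "\<And>s. s \<in> S \<Longrightarrow> E (e s) s"
    and Q: "Q \<inter> S = {}" "Q \<inter> e ` S = {}" and V: "V = S \<union> e ` S \<union> Q"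
    and P: "P \<subseteq> Q" "\<And>x. x \<in> P \<Longrightarrow> \<exists>xs. is_path E (xs @ [x]) \<and> set (xs @ [x]) = Q"
    and \<Q>: "partition_on P \<Q>" "separated E \<Q>" "card (Q - P) < card \<Q>"
  shows "path_cover E V (card C)"
proof (rule ccontr)
  assume no_cover: "\<not> path_cover E V (card C)"
  have finS: "finite S" "finite Q" using assms(2) V by auto
  have "\<Q> \<noteq> {}" using \<Q>(3) by auto
  then have "P \<noteq> {}" using \<Q>(1) partition_on_empty by blast
  then have Q_ne: "Q \<noteq> {}" using P(1) by blast
  \<comment> \<open>The end pieces are \<open>Q\<close> and the singletons \<open>{e s}\<close>, one
    piece more than there are middle nodes. \<open>N T\<close> collects the middle nodes to which
    \<open>T\<close> can be attached through one of its tips.\<close>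
  define \<T> where "\<T> = insert Q ((\<lambda>s. {e s}) ` S)"
  define tips where "tips T = (if T = Q then P else T)" for T
  define N where "N T = {s \<in> S. \<exists>x\<in>tips T. E x s}" for T
  have Q_single: "Q \<noteq> {e s}" if "s \<in> S" for s using that Q(2) by blast
  have in_N: "s \<in> N {e s}" if "s \<in> S" for s
    using that e(3) Q_single[OF that] by (auto simp: N_def tips_def)
  have fin\<T>: "finite \<T>" using finS by (simp add: \<T>_def)
  have card_singles: "card ((\<lambda>s. {e s}) ` R) = card R" if "R \<subseteq> S" for R
    using that e(1) by (intro card_image) (auto simp: inj_on_def)
  have "Q \<notin> (\<lambda>s. {e s}) ` S" using Q_single by blast
  then have card\<T>: "card \<T> = Suc (card S)"
    using finS card_singles[of S] by (simp add: \<T>_def)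
  have \<T>_disj: "T \<inter> T' = {}" if "T \<in> \<T>" "T' \<in> \<T>" "T \<noteq> T'" for T T'
    using that Q(2) unfolding \<T>_def by auto
  have \<T>_Un: "\<Union>\<T> = e ` S \<union> Q" unfolding \<T>_def by auto
  have \<T>_S: "T \<inter> S = {}" if "T \<in> \<T>" for T using that e(2) Q(1) unfolding \<T>_def by auto
  have tip_path: "\<exists>xs. is_path E (xs @ [x]) \<and> set (xs @ [x]) = T" if "T \<in> \<T>" "x \<in> tips T" for T x
  proof (cases "T = Q")
    case True
    then show ?thesis using P(2) that by (simp add: tips_def)
  next
    case False
    then have "T = {x}" using that unfolding \<T>_def tips_def by auto
    then show ?thesis by (intro exI[of _ "[]"]) simp
  qed
  have attachedI: "attached E T s" if T: "T \<in> \<T>" "s \<in> N T" for T s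
  proof -
    have s: "s \<in> S" and "\<exists>x\<in>tips T. E x s" using T unfolding N_def by auto
    then obtain x xs where x: "E x s" "is_path E (xs @ [x])" "set (xs @ [x]) = T"
      using tip_path[OF T(1)] by blast
    have "s \<notin> T" using \<T>_S[OF T(1)] s by blast
    then have "is_path E ((xs @ [x]) @ [s])" using x by (subst is_path_append) auto
    then show ?thesis using x(3) unfolding attached_def by blast
  qed

  \<comment> \<open>A bad family violates Hall's condition. The whole of \<open>\<T>\<close> is bad
    by the count above, so a bad family of least size exists.\<close>
  define bad where "bad \<D> \<longleftrightarrow> \<D> \<subseteq> \<T> \<and> card (\<Union>(N ` \<D>)) < card \<D>" for \<D>
  have NS: "\<Union>(N ` \<D>) \<subseteq> S" for \<D> unfolding N_def by blast
  have finN: "finite (\<Union>(N ` \<D>))" for \<D> using finite_subset[OF NS finS(1)] .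
  have "bad \<T>" using card_mono[OF finS(1) NS, of \<T>] card\<T> unfolding bad_def by simp
  then obtain \<D> where "bad \<D>" and min: "\<And>\<D>'. bad \<D>' \<Longrightarrow> card \<D> \<le> card \<D>'"
    using ex_has_least_nat[of bad \<T> card] by blast
  then have \<D>: "\<D> \<subseteq> \<T>" "card (\<Union>(N ` \<D>)) < card \<D>" unfolding bad_def by auto
  have fin\<D>: "finite \<D>" using \<D>(1) fin\<T> finite_subset by blast
  define A where "A = \<Union>(N ` \<D>)"
  have A: "A \<subseteq> S" "finite A" using NS finN unfolding A_def by blast+
  \<comment> \<open>Every \<open>{e s}\<close> can be attached to its own \<open>s\<close>, whence
    \<open>R \<subseteq> A\<close>. As \<open>\<D>\<close> has at most one member besides the
    singletons from \<open>R\<close>, the bound \<open>card A < card \<D>\<close> forces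
    \<open>R = A\<close> and \<open>Q \<in> \<D>\<close>.\<close>
  define R where "R = {s \<in> S. {e s} \<in> \<D>}"
  have "R \<subseteq> A" using in_N unfolding R_def A_def by blast
  have D_sub: "\<D> \<subseteq> insert Q ((\<lambda>s. {e s}) ` R)" using \<D>(1) unfolding \<T>_def R_def by blast
  have "R \<subseteq> S" unfolding R_def by blast
  have finR: "finite R" using \<open>R \<subseteq> S\<close> finS(1) finite_subset by blast
  have card_le: "card \<D> \<le> Suc (card R)"
    using card_mono[OF _ D_sub] finR card_singles[OF \<open>R \<subseteq> S\<close>]
    by (simp add: card_insert_if split: if_splits)
  have cRA: "card R \<le> card A" using card_mono[OF A(2) \<open>R \<subseteq> A\<close>] .
  have cA: "card A < card \<D>" using \<D>(2) unfolding A_def .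
  have "card R = card A" using card_le cRA cA by linarith
  then have RA: "R = A" using card_subset_eq[OF A(2) \<open>R \<subseteq> A\<close>] by blast
  have cD: "card \<D> = Suc (card A)" using card_le cRA cA by linarith
  have "Q \<in> \<D>"
  proof (rule ccontr)
    assume "Q \<notin> \<D>"
    then have "\<D> \<subseteq> (\<lambda>s. {e s}) ` R" using D_sub by blast
    from card_mono[OF _ this] have "card \<D> \<le> card R"
      using finR card_singles[OF \<open>R \<subseteq> S\<close>] by simp
    then show False using cD RA by simp
  qed

  \<comment> \<open>No proper subfamily of \<open>\<D>\<close> is bad, so Hall's theorem matches
    \<open>\<D> - {T}\<close> into \<open>A\<close>, and onto it because
    \<open>card \<D> = card A + 1\<close>. Nodes outside \<open>A\<close> keep their own end, which
    leaves exactly \<open>T\<close> over.\<close>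
  have rematch: "\<exists>\<tau>. inj_on \<tau> S \<and> \<tau> ` S = \<T> - {T} \<and> (\<forall>s\<in>S. s \<in> N (\<tau> s))" if T: "T \<in> \<D>" for T
  proof -
    have "\<exists>f. inj_on f (\<D> - {T}) \<and> (\<forall>D\<in>\<D> - {T}. f D \<in> N D)"
    proof (rule hall)
      show "finite (N D)" for D using finN[of "{D}"] by simp
      fix J assume J: "J \<subseteq> \<D> - {T}"
      then have "card J < card \<D>" using T fin\<D> by (intro psubset_card_mono) auto
      then have "\<not> bad J" using min[of J] by linarith
      moreover have "J \<subseteq> \<T>" using J \<D>(1) by blast
      ultimately show "card J \<le> card (\<Union>(N ` J))" unfolding bad_def by linarith
    qed (use fin\<D> in simp)
    then obtain f where f: "inj_on f (\<D> - {T})" "\<And>D. D \<in> \<D> - {T} \<Longrightarrow> f D \<in> N D" by blast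
    have "f ` (\<D> - {T}) \<subseteq> A" using f(2) unfolding A_def by blast
    moreover have "card (f ` (\<D> - {T})) = card A"
      using card_image[OF f(1)] cD T fin\<D> by simp
    ultimately have fA: "f ` (\<D> - {T}) = A" using card_subset_eq[OF A(2)] by blast
    define f' where "f' = the_inv_into (\<D> - {T}) f"
    have f': "f' s \<in> \<D> - {T}" "f (f' s) = s" if "s \<in> A" for s
      using the_inv_into_into[OF f(1), of s "\<D> - {T}"] f_the_inv_into_f[OF f(1), of s] that fA
      unfolding f'_def by simp_all
    define \<tau> where "\<tau> s = (if s \<in> A then f' s else {e s})" for s
    have out: "{e s} \<in> \<T> - \<D>" if "s \<in> S" "s \<notin> A" for s
      using that RA unfolding R_def \<T>_def by blast
    have "inj_on \<tau> S"
    proof (rule inj_onI)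
      fix s s' assume s: "s \<in> S" "s' \<in> S" "\<tau> s = \<tau> s'"
      show "s = s'"
      proof (cases "s \<in> A \<longleftrightarrow> s' \<in> A")
        case True
        then show ?thesis using s f'(2) inj_onD[OF e(1), of s s'] unfolding \<tau>_def by (metis singleton_inject)
      next
        case False
        then show ?thesis using s f'(1) out unfolding \<tau>_def by (metis DiffD1 DiffD2)
      qed
    qed
    moreover have "\<tau> ` S = \<T> - {T}"
    proof (rule card_subset_eq)
      show "finite (\<T> - {T})" using fin\<T> by simp
      show "\<tau> ` S \<subseteq> \<T> - {T}"
      proof
        fix D assume "D \<in> \<tau> ` S"
        then obtain s where s: "s \<in> S" "D = \<tau> s" by blast
        show "D \<in> \<T> - {T}"
        proof (cases "s \<in> A")
          case True
          then show ?thesis using f'(1)[OF True] s \<D>(1) unfolding \<tau>_def by auto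
        next
          case False
          then show ?thesis using out[OF s(1) False] s(2) T unfolding \<tau>_def by auto
        qed
      qed
      have "T \<in> \<T>" using T \<D>(1) by blast
      then show "card (\<tau> ` S) = card (\<T> - {T})"
        using card_image[OF \<open>inj_on \<tau> S\<close>] card\<T> fin\<T> by simp
    qed
    moreover have "s \<in> N (\<tau> s)" if "s \<in> S" for s
    proof (cases "s \<in> A")
      case True
      then show ?thesis using f(2)[OF f'(1)[OF True]] f'(2)[OF True] by (simp add: \<tau>_def)
    next
      case False
      then show ?thesis using in_N[OF that] by (simp add: \<tau>_def)
    qed
    ultimately show ?thesis by blast
  qed

  \<comment> \<open>With \<open>T\<close> left over, let \<open>s\<close> be the node now carrying
    \<open>{e r}\<close>. An edge from a tip of \<open>T\<close> to \<open>e r\<close> makes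
    \<open>T\<close>, followed by \<open>e r\<close>, a tail of \<open>s\<close>. All pieces are
    then absorbed without an additional path.\<close>
  have no_join: "\<not> E x (e r)" if T: "T \<in> \<D>" "x \<in> tips T" and r: "r \<in> S" "{e r} \<noteq> T" for T x r
  proof
    assume edge: "E x (e r)"
    from rematch[OF T(1)] obtain \<tau>
      where "inj_on \<tau> S \<and> \<tau> ` S = \<T> - {T} \<and> (\<forall>s\<in>S. s \<in> N (\<tau> s))" by metis
    then have \<tau>: "inj_on \<tau> S" "\<tau> ` S = \<T> - {T}" "\<And>s. s \<in> S \<Longrightarrow> s \<in> N (\<tau> s)" by simp_all
    have T\<T>: "T \<in> \<T>" using T(1) \<D>(1) by blast
    have "{e r} \<in> \<tau> ` S" unfolding \<tau>(2) using r by (auto simp: \<T>_def)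
    then obtain s where s: "s \<in> S" "\<tau> s = {e r}" by auto
    have \<tau>\<T>: "\<tau> s' \<in> \<T>" "\<tau> s' \<noteq> T" if "s' \<in> S" for s' using \<tau>(2) that by blast+
    define \<sigma> where "\<sigma> = \<tau>(s := T \<union> {e r})"
    obtain xs where xs: "is_path E (xs @ [x])" "set (xs @ [x]) = T"
      using tip_path[OF T\<T> T(2)] by blast
    have "e r \<notin> T" using \<T>_disj[of "{e r}" T] \<tau>\<T>(1)[OF s(1)] s(2) T\<T> r by auto
    have "{e r} \<noteq> Q" using Q_single[OF r(1)] by simp
    then have er_s: "E (e r) s" using \<tau>(3)[OF s(1)] s(2) unfolding N_def tips_def by auto
    have "s \<notin> T" using \<T>_S[OF T\<T>] s(1) by blast
    moreover have "s \<noteq> e r" using s(1) e(2)[OF r(1)] by blast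
    ultimately have "is_path E ((xs @ [x]) @ [e r, s])"
      using xs edge er_s \<open>e r \<notin> T\<close> by (subst is_path_append) (auto simp: is_path_def)
    then have "is_path E ((xs @ [x, e r]) @ [s])" by simp
    moreover have "set (xs @ [x, e r]) = T \<union> {e r}" using xs(2) by auto
    ultimately have att_s: "attached E (T \<union> {e r}) s" unfolding attached_def by blast
    have "path_cover E (S \<union> \<Union>(\<sigma> ` S)) (card C)"
    proof (rule path_cover_attached[OF assms(1) finS(1)])
      show "partition_on S C" using C unfolding perfect_matching_def by blast
      show "\<exists>x y. B = {x, y} \<and> (x = y \<or> E x y)" if "B \<in> C" for B
        using C that unfolding perfect_matching_def by blast
      show "attached E (\<sigma> s') s'" if "s' \<in> S" for s'
        using att_s attachedI[OF \<tau>\<T>(1)[OF that] \<tau>(3)[OF that]] by (simp add: \<sigma>_def)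
      show "\<sigma> s' \<inter> S = {}" if "s' \<in> S" for s'
        using \<T>_S[OF \<tau>\<T>(1)[OF that]] \<T>_S[OF T\<T>] e(2)[OF r(1)] by (simp add: \<sigma>_def)
      show "disjoint_family_on \<sigma> S"
        unfolding disjoint_family_on_def
      proof (intro ballI impI)
        fix p q assume pq: "p \<in> S" "q \<in> S" "p \<noteq> q"
        have disj: "\<tau> p \<inter> \<tau> q = {}"
          using \<T>_disj[OF \<tau>\<T>(1)[OF pq(1)] \<tau>\<T>(1)[OF pq(2)]] inj_onD[OF \<tau>(1) _ pq(1,2)] pq(3) by blast
        have T_disj: "\<tau> p \<inter> T = {}" "\<tau> q \<inter> T = {}"
          using \<T>_disj[OF \<tau>\<T>(1) T\<T>] \<tau>\<T>(2) pq by auto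
        show "\<sigma> p \<inter> \<sigma> q = {}"
          using disj T_disj s(2) pq(3) by (auto simp: \<sigma>_def)
      qed
    qed
    moreover have "\<Union>(\<sigma> ` S) = \<Union>(\<tau> ` S) \<union> T"
    proof -
      have "\<Union>(\<sigma> ` S) = \<sigma> s \<union> \<Union>(\<sigma> ` (S - {s}))" using s(1) by blast
      also have "\<dots> = (T \<union> \<tau> s) \<union> \<Union>(\<tau> ` (S - {s}))" by (simp add: \<sigma>_def s(2))
      also have "\<dots> = \<Union>(\<tau> ` S) \<union> T" using s(1) by blast
      finally show ?thesis .
    qed
    moreover have "\<Union>(\<tau> ` S) \<union> T = \<Union>\<T>" unfolding \<tau>(2) using T\<T> by blast
    ultimately show False using no_cover \<T>_Un V by (simp add: Un_assoc)
  qed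

  \<comment> \<open>By \<open>no_join\<close> there are no edges between different pieces of
    \<open>\<K>\<close>, and edges from them to middle nodes end in \<open>A\<close>. There are
    \<open>card A + card \<Q>\<close> pieces, more than \<open>card W\<close>, which contradicts
    toughness.\<close>
  define W where "W = A \<union> (Q - P)"
  define \<K> where "\<K> = (\<lambda>s. {e s}) ` A \<union> \<Q>"
  have PQ: "P = \<Union>\<Q>" using \<Q>(1) by (rule partition_onD1)
  have Q_in: "K \<subseteq> P" if "K \<in> \<Q>" for K using that PQ by blast
  have eA: "e s \<notin> Q" "e s \<notin> S" if "s \<in> A" for s using that A(1) Q(2) e(2) by blast+
  have "card \<K> \<le> card W + 0"
  proof (rule toughD[OF tough])
    show "W \<subseteq> V" using A(1) V unfolding W_def by blast
    show "disjoint \<K>"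
      unfolding disjoint_def
    proof (intro ballI impI)
      fix K L assume KL: "K \<in> \<K>" "L \<in> \<K>" "K \<noteq> L"
      have single: "{e s} \<inter> M = {}" if "s \<in> A" "M \<in> \<Q>" for s M
        using eA(1)[OF that(1)] Q_in[OF that(2)] P(1) by blast
      show "K \<inter> L = {}"
        using KL single disjointD[OF partition_onD2[OF \<Q>(1)], of K L] unfolding \<K>_def
        by (elim UnE imageE) (auto simp: Int_commute)
    qed
    show "K \<noteq> {}" if "K \<in> \<K>" for K using that partition_onD3[OF \<Q>(1)] unfolding \<K>_def by blast
    \<comment> \<open>The inclusion is proper because the nonempty set \<open>S\<close> is disjoint
      from all pieces.\<close>
    show "K \<subset> V" if "K \<in> \<K>" for K
    proof -
      have "K \<subseteq> e ` S \<union> Q" using that A(1) Q_in P(1) unfolding \<K>_def by blast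
      moreover have "S \<inter> (e ` S \<union> Q) = {}" using e(2) Q(1) by blast
      ultimately show ?thesis using V \<open>S \<noteq> {}\<close> by blast
    qed
    show "K \<inter> W = {}" if "K \<in> \<K>" for K
      using that eA A(1) Q_in P(1) Q(1) unfolding \<K>_def W_def by blast
    fix K x y assume K: "K \<in> \<K>" "x \<in> K" and y: "y \<in> V" "E x y" "y \<notin> W"
    from K(1) consider s where "s \<in> A" "K = {e s}" | "K \<in> \<Q>" unfolding \<K>_def by blast
    then show "y \<in> K"
    proof cases
      case 1
      have D: "{e s} \<in> \<D>" "s \<in> S" using 1(1) RA unfolding R_def by blast+
      have x: "x = e s" "x \<in> tips {e s}" using 1(2) K(2) Q_single[OF D(2)] by (auto simp: tips_def)
      have "y \<notin> S"
      proof
        assume "y \<in> S"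
        then have "y \<in> A" using x(2) y(2) D(1) unfolding A_def N_def by blast
        then show False using y(3) W_def by blast
      qed
      moreover have "y \<notin> Q"
      proof
        assume "y \<in> Q"
        then have "y \<in> P" using y(3) unfolding W_def by blast
        then have "\<not> E y (e s)"
          using no_join[OF \<open>Q \<in> \<D>\<close>, of y s] D(2) Q_single[OF D(2)] by (simp add: tips_def)
        then show False using y(2) x(1) sympD[OF assms(1)] by blast
      qed
      ultimately obtain r where r: "r \<in> S" "y = e r" using y(1) V by blast
      then have "{e r} = {e s}" using no_join[OF D(1) x(2), of r] y(2) by blast
      then show ?thesis using r(2) 1(2) by blast
    next
      case 2
      have x: "x \<in> P" "x \<in> tips Q" using Q_in[OF 2] K(2) by (auto simp: tips_def)
      have "y \<notin> S"
      proof
        assume "y \<in> S"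
        then have "y \<in> A" using x(2) y(2) \<open>Q \<in> \<D>\<close> unfolding A_def N_def by blast
        then show False using y(3) W_def by blast
      qed
      moreover have "y \<notin> e ` S" using no_join[OF \<open>Q \<in> \<D>\<close> x(2)] Q_single y(2) by blast
      ultimately have "y \<in> P" using y(1,3) V unfolding W_def by blast
      then obtain L where "L \<in> \<Q>" "y \<in> L" using PQ by blast
      then show ?thesis using separatedD[OF \<Q>(2) 2, of L x y] K(2) y(2) by blast
    qed
  qed
  moreover have "card \<K> = card A + card \<Q>"
  proof -
    have "(\<lambda>s. {e s}) ` A \<inter> \<Q> = {}" using eA Q_in P(1) by blast
    moreover have "finite \<Q>"
      using finite_elements[OF finite_subset[OF P(1) finS(2)] \<Q>(1)] .
    ultimately show ?thesis unfolding \<K>_def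
      using card_singles[OF A(1)] A(2) by (simp add: card_Un_disjoint)
  qed
  moreover have "card W \<le> card A + card (Q - P)" unfolding W_def by (rule card_Un_le)
  ultimately show False using \<Q>(3) by linarith
qed

text \<open>Toughness with \<open>W = A\<close> bounds the number of blocks of the Gallai--Edmonds
  decomposition by \<open>card A\<close>, so \<open>g\<close> is a bijection onto the blocks and
  everything is matched. Toughness only speaks of proper subsets; the exception is that
  \<open>V\<close> is itself a block.\<close>

lemma near_perfect_matching:
  assumes "finite V" "symp E" "tough E V 0" "V \<noteq> {}"
  shows "matchable E V \<or> odd (card V) \<and> factor_critical E V"
proof -
  obtain A \<K> g where A: "A \<subseteq> V" "partition_on (V - A) \<K>" "separated E \<K>"
    and crit: "\<And>K. K \<in> \<K> \<Longrightarrow> factor_critical E K"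
    and g: "inj_on g A" "\<And>a. a \<in> A \<Longrightarrow> g a \<in> \<K> \<and> (\<exists>x\<in>g a. E a x)"
    using factor_critical_decomposition[OF assms(1,2)] by metis
  have VA: "V - A = \<Union>\<K>" using A(2) by (rule partition_onD1)
  have fin\<K>: "finite \<K>" using finite_elements[OF finite_Diff[OF assms(1)] A(2)] .
  show ?thesis
  proof (cases "V \<in> \<K>")
    case True
    then show ?thesis using crit factor_critical_odd[OF assms(1)] by blast
  next
    case False
    have "card \<K> \<le> card A + 0"
    proof (rule toughD[OF assms(3) A(1) partition_onD2[OF A(2)]])
      fix K assume K: "K \<in> \<K>"
      then show "K \<noteq> {}" using partition_onD3[OF A(2)] by blast
      have "K \<subseteq> V - A" using K VA by blast
      then show "K \<subset> V" "K \<inter> A = {}" using False K by blast+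
      show "y \<in> K" if "x \<in> K" "y \<in> V" "E x y" "y \<notin> A" for x y
      proof -
        have "y \<in> \<Union>\<K>" using that(2,4) VA by blast
        then obtain L where L: "L \<in> \<K>" "y \<in> L" by blast
        then show ?thesis using separatedD[OF A(3) K L(1) _ that(1) L(2)] that(3) by blast
      qed
    qed
    moreover have "g ` A \<subseteq> \<K>" using g(2) by blast
    ultimately have "g ` A = \<K>"
      using card_image[OF g(1)] card_seteq[OF fin\<K>] by simp
    then show ?thesis
      using matchable_decomposition[OF assms(1) A(1,2) crit g(1)] g(2) by blast
  qed
qed

section \<open>Contracting a near-perfect matching\<close>

text \<open>The case \<open>x = y\<close> accommodates the single unmatched node of a near-perfect
  matching.\<close>

definition supernode :: "('a \<Rightarrow> 'a \<Rightarrow> bool) \<Rightarrow> 'a set \<Rightarrow> bool" where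
  "supernode E X \<longleftrightarrow> (\<exists>x y. X = {x, y} \<and> (x = y \<or> E x y))"

definition contract :: "('a \<Rightarrow> 'a \<Rightarrow> bool) \<Rightarrow> 'a set \<Rightarrow> 'a set \<Rightarrow> bool" where
  "contract E X Y \<longleftrightarrow> (\<exists>x\<in>X. \<exists>y\<in>Y. E x y)"

lemma symp_contract: "symp E \<Longrightarrow> symp (contract E)"
  unfolding contract_def by (intro sympI) (meson sympD)

lemma attached_Diff:
  assumes "symp E" "supernode E X" "x \<in> X" shows "attached E (X - {x}) x"
proof -
  obtain y where y: "X = {x, y}" "x = y \<or> E y x"
    using assms unfolding supernode_def by (metis doubleton_eq_iff insertE singletonD sympD)
  show ?thesis
  proof (cases "x = y")
    case True
    then show ?thesis unfolding attached_def using y(1) by (intro exI[of _ "[]"]) simp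
  next
    case False
    then show ?thesis unfolding attached_def using y
      by (intro exI[of _ "[y]"]) (auto simp: is_path_def)
  qed
qed

lemma attached_extend:
  assumes "attached E (X - {x}) x" "x \<in> X" "E x u" "u \<notin> X" shows "attached E X u"
proof -
  obtain xs where xs: "is_path E (xs @ [x])" "set xs = X - {x}"
    using assms(1) unfolding attached_def by blast
  have "is_path E ((xs @ [x]) @ [u])"
    using xs assms(2-4) by (subst is_path_append) auto
  moreover have "set (xs @ [x]) = X" using xs(2) assms(2) by auto
  ultimately show ?thesis unfolding attached_def by blast
qed

text \<open>An edge \<open>E x y\<close> realising a contracted edge becomes the middle of a path;
  the other node of each supernode, if any, hangs on as a tail. Each matched pair of supernodes
  therefore costs one path.\<close>

lemma path_cover_contracted_matching:
  assumes "symp E" "finite \<H>" "disjoint \<H>" "\<And>X. X \<in> \<H> \<Longrightarrow> supernode E X"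
    and M: "perfect_matching (contract E) \<H> M"
  shows "path_cover E (\<Union>\<H>) (card M)"
proof -
  have HM: "\<H> = \<Union>M" and Mdisj: "disjoint M"
    using M unfolding perfect_matching_def partition_on_def by auto
  have "path_cover E (\<Union>p\<in>M. \<Union>p) (\<Sum>p\<in>M. 1)"
  proof (rule path_cover_UN)
    show "finite M" using M finite_elements[OF assms(2)] unfolding perfect_matching_def by blast
    fix p assume p: "p \<in> M"
    obtain X Y where XY: "p = {X, Y}" "X \<noteq> Y" "contract E X Y"
      using perfect_matchingE[OF M p] .
    have H: "X \<in> \<H>" "Y \<in> \<H>" using p XY(1) HM by blast+
    have XYd: "X \<inter> Y = {}" using disjointD[OF assms(3) H XY(2)] .
    obtain x y where xy: "x \<in> X" "y \<in> Y" "E x y" using XY(3) unfolding contract_def by blast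
    define T where "T s = (if s = x then X - {x} else Y - {y})" for s
    have "path_cover E ({x, y} \<union> \<Union>(T ` {x, y})) (card {{x, y}})"
    proof (rule path_cover_attached[OF assms(1)])
      show "partition_on {x, y} {{x, y}}" by (simp add: partition_on_space)
      show "\<exists>u v. B = {u, v} \<and> (u = v \<or> E u v)" if "B \<in> {{x, y}}" for B
        using that xy(3) by blast
      have "x \<noteq> y" using xy XYd by blast
      then show "attached E (T s) s" if "s \<in> {x, y}" for s
        using that attached_Diff[OF assms(1) assms(4)] H xy unfolding T_def by auto
      show "T s \<inter> {x, y} = {}" if "s \<in> {x, y}" for s
        using that xy XYd unfolding T_def by auto
      show "disjoint_family_on T {x, y}"
        using XYd unfolding disjoint_family_on_def T_def by auto
    qed simp
    moreover have "{x, y} \<union> \<Union>(T ` {x, y}) = \<Union>p"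
      using xy XYd unfolding T_def XY(1) by auto
    ultimately show "path_cover E (\<Union>p) 1" by simp
  next
    show "disjoint_family_on Union M"
      unfolding disjoint_family_on_def
    proof (intro ballI impI)
      fix p q assume pq: "p \<in> M" "q \<in> M" "p \<noteq> q"
      then have "p \<inter> q = {}" using disjointD[OF Mdisj] by blast
      then have "X \<inter> Y = {}" if "X \<in> p" "Y \<in> q" for X Y
        using disjointD[OF assms(3), of X Y] that pq HM by blast
      then show "\<Union>p \<inter> \<Union>q = {}" by blast
    qed
  qed
  moreover have "(\<Union>p\<in>M. \<Union>p) = \<Union>\<H>" unfolding HM by blast
  ultimately show ?thesis by simp
qed

text \<open>Produces the input of \<open>absorb_leftover\<close>: for every matched pair of matching
  edges, the four-node path is recorded by its middle edge in \<open>C\<close> and by the map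
  \<open>e\<close> from middle nodes to the adjacent ends.\<close>

lemma contracted_matching_middles:
  assumes "symp E" "finite \<H>" "disjoint \<H>" "\<And>X. X \<in> \<H> \<Longrightarrow> \<exists>x y. X = {x, y} \<and> x \<noteq> y \<and> E x y"
    and M: "perfect_matching (contract E) \<H> M"
  obtains S C e where "perfect_matching E S C" "inj_on e S" "\<And>s. s \<in> S \<Longrightarrow> e s \<notin> S"
    "\<And>s. s \<in> S \<Longrightarrow> E (e s) s" "\<Union>\<H> = S \<union> e ` S"
proof -
  have HM: "\<H> = \<Union>M" and Mdisj: "disjoint M"
    using M unfolding perfect_matching_def partition_on_def by auto
  have finM: "finite M" using M finite_elements[OF assms(2)] unfolding perfect_matching_def by blast
  have "\<exists>S C e. perfect_matching E S C \<and> inj_on e S \<and> e ` S \<inter> S = {} \<and>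
      (\<forall>s\<in>S. E (e s) s) \<and> \<Union>(\<Union>F) = S \<union> e ` S" if "F \<subseteq> M" "finite F" for F
    using that(2,1)
  proof (induction F rule: finite_induct)
    case empty
    show ?case
      by (intro exI[of _ "{}"] exI[of _ id]) (simp add: perfect_matching_def partition_on_empty)
  next
    case (insert p F)
    have "F \<subseteq> M" using insert.prems by simp
    from insert.IH[OF this] obtain S C e where IH: "perfect_matching E S C" "inj_on e S" "e ` S \<inter> S = {}"
      "\<forall>s\<in>S. E (e s) s" "\<Union>(\<Union>F) = S \<union> e ` S" by metis
    have p: "p \<in> M" using insert.prems by blast
    obtain X Y where XY: "p = {X, Y}" "X \<noteq> Y" "contract E X Y"
      using perfect_matchingE[OF M p] .
    have H: "X \<in> \<H>" "Y \<in> \<H>" using p XY(1) HM by blast+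
    have XYd: "X \<inter> Y = {}" using disjointD[OF assms(3) H XY(2)] .
    obtain x y where xy: "x \<in> X" "y \<in> Y" "E x y" using XY(3) unfolding contract_def by blast
    obtain x' where x': "X = {x, x'}" "x \<noteq> x'" "E x' x"
      using assms(4)[OF H(1)] xy(1) assms(1) by (metis doubleton_eq_iff insertE singletonD sympD)
    obtain y' where y': "Y = {y, y'}" "y \<noteq> y'" "E y' y"
      using assms(4)[OF H(2)] xy(2) assms(1) by (metis doubleton_eq_iff insertE singletonD sympD)
    have "Z \<inter> Z' = {}" if Z: "Z \<in> p" "Z' \<in> \<Union>F" for Z Z'
    proof -
      obtain q where q: "q \<in> F" "Z' \<in> q" using Z(2) by blast
      then have "p \<noteq> q" using insert.hyps by blast
      then have "p \<inter> q = {}" using disjointD[OF Mdisj p, of q] q insert.prems by blast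
      then have "Z \<noteq> Z'" using Z(1) q(2) by blast
      moreover have "Z \<in> \<H>" "Z' \<in> \<H>" using Z(1) p q insert.prems HM by blast+
      ultimately show ?thesis using disjointD[OF assms(3)] by blast
    qed
    then have "\<Union>p \<inter> \<Union>(\<Union>F) = {}" by blast
    then have new: "{x, x', y, y'} \<inter> (S \<union> e ` S) = {}"
      unfolding IH(5) XY(1) x'(1) y'(1) by auto
    have dist: "x \<noteq> y" "x \<noteq> y'" "x' \<noteq> y" "x' \<noteq> y'" using XYd x'(1) y'(1) by auto
    define e' where "e' = e(x := x', y := y')"
    have "partition_on ({x, y} \<union> S) ({{x, y}} \<union> C)"
      using IH(1) new unfolding perfect_matching_def
      by (intro partition_on_Un) (auto simp: partition_on_space)
    then have "perfect_matching E ({x, y} \<union> S) ({{x, y}} \<union> C)"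
      using IH(1) xy(3) dist(1) unfolding perfect_matching_def by auto
    moreover have e'S: "e' s = e s" if "s \<in> S" for s using that new unfolding e'_def by auto
    then have im: "e' ` S = e ` S" by (intro image_cong) auto
    have "inj_on e' S" using IH(2) e'S inj_on_cong[of S e' e] by blast
    then have "inj_on e' ({x, y} \<union> S)"
      using dist x'(2) y'(2) new im by (auto simp: e'_def[symmetric] inj_on_insert) (auto simp: e'_def)
    moreover have im': "e' ` ({x, y} \<union> S) = {x', y'} \<union> e ` S"
      using im dist(1) by (auto simp: e'_def)
    then have "e' ` ({x, y} \<union> S) \<inter> ({x, y} \<union> S) = {}"
      using IH(3) new dist x'(2) y'(2) by auto
    moreover have "\<forall>s\<in>{x, y} \<union> S. E (e' s) s"
      using IH(4) e'S x'(3) y'(3) by (auto simp: e'_def)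
    moreover have "\<Union>(\<Union>(insert p F)) = ({x, y} \<union> S) \<union> e' ` ({x, y} \<union> S)"
      unfolding im' using IH(5) XY(1) x'(1) y'(1) by auto
    ultimately show ?case by blast
  qed
  from this[OF order_refl finM] show ?thesis using that HM by (metis disjoint_iff image_eqI)
qed

text \<open>A supernode that is not a single node; two of these joined by an edge give a path on
  exactly four nodes.\<close>

definition match_edge :: "('a \<Rightarrow> 'a \<Rightarrow> bool) \<Rightarrow> 'a set \<Rightarrow> bool" where
  "match_edge E X \<longleftrightarrow> (\<exists>x y. X = {x, y} \<and> x \<noteq> y \<and> E x y)"

lemma match_edge_supernode: "match_edge E X \<Longrightarrow> supernode E X"
  unfolding match_edge_def supernode_def by blast

text \<open>Carries \<open>absorb_leftover\<close> over to the contracted graph. The paths number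
  \<open>card C\<close>, and their middles and ends alone make up \<open>4 * card C\<close> nodes of
  \<open>V\<close>, so the nodes of \<open>Q\<close> are covered for free.\<close>

lemma leftover_cover:
  assumes "symp E" "finite V" "tough E V 0"
    and \<G>: "disjoint \<G>" "\<And>X. X \<in> \<G> \<Longrightarrow> match_edge E X" "matchable (contract E) \<G>" "\<G> \<noteq> {}"
    and Q: "Q \<inter> \<Union>\<G> = {}" and V: "V = \<Union>\<G> \<union> Q"
    and P: "P \<subseteq> Q" "\<And>x. x \<in> P \<Longrightarrow> attached E (Q - {x}) x"
    and \<Q>: "partition_on P \<Q>" "separated E \<Q>" "card (Q - P) < card \<Q>"
  shows "\<exists>p. path_cover E V p \<and> 4 * p \<le> card V"
proof -
  have fin\<G>: "finite \<G>" using assms(2) V by (metis finite_UnionD finite_Un)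
  obtain M where M: "perfect_matching (contract E) \<G> M" using \<G>(3) unfolding matchable_def by blast
  obtain S C e where C: "perfect_matching E S C" and e: "inj_on e S" "\<And>s. s \<in> S \<Longrightarrow> e s \<notin> S"
    "\<And>s. s \<in> S \<Longrightarrow> E (e s) s" and U: "\<Union>\<G> = S \<union> e ` S"
    using contracted_matching_middles[OF assms(1) fin\<G> \<G>(1) _ M] \<G>(2) unfolding match_edge_def by metis
  obtain X where X: "X \<in> \<G>" using \<G>(4) by blast
  then have "X \<noteq> {}" using \<G>(2) unfolding match_edge_def by blast
  then have "S \<noteq> {}" using U X by blast
  have VS: "V = S \<union> e ` S \<union> Q" using U V by simp
  then have finS: "finite S" using assms(2) by simp
  have "path_cover E V (card C)"
  proof (rule absorb_leftover[OF assms(1-3) C \<open>S \<noteq> {}\<close> e _ _ VS P(1) _ \<Q>])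
    show "Q \<inter> S = {}" "Q \<inter> e ` S = {}" using Q U by blast+
    show "\<exists>xs. is_path E (xs @ [x]) \<and> set (xs @ [x]) = Q" if x: "x \<in> P" for x
    proof -
      obtain xs where "is_path E (xs @ [x])" "set xs = Q - {x}"
        using P(2)[OF x] unfolding attached_def by blast
      then show ?thesis using P(1) x by (intro exI[of _ xs]) auto
    qed
  qed
  moreover have "4 * card C \<le> card V"
  proof -
    have "S \<inter> e ` S = {}" using e(2) by blast
    then have "card (S \<union> e ` S) = 2 * card S"
      using finS card_image[OF e(1)] by (simp add: card_Un_disjoint)
    moreover have "card (S \<union> e ` S) \<le> card V" using assms(2) VS by (intro card_mono) auto
    ultimately show ?thesis using perfect_matching_card[OF finS C] by simp
  qed
  ultimately show ?thesis by blast
qed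

section \<open>Covering a 1-tough graph by at most a quarter as many paths as nodes\<close>

lemma perfect_matching_remove:
  assumes "perfect_matching E V M" "p \<in> M"
  shows "perfect_matching E (V - p) (M - {p})"
  using assms partition_on_remove[of V M p] unfolding perfect_matching_def by simp

text \<open>\<open>X0\<close> absorbs the parity: it is the unmatched node in the factor-critical
  case and an arbitrary matching edge otherwise.\<close>

lemma supernodes_exist:
  assumes "finite V" "symp E" "tough E V 0" "V \<noteq> {}"
  obtains \<H> X0 where "partition_on V \<H>" "X0 \<in> \<H>" "supernode E X0"
    "\<And>X. X \<in> \<H> - {X0} \<Longrightarrow> match_edge E X"
  using near_perfect_matching[OF assms]
proof
  assume "matchable E V"
  then obtain M where M: "perfect_matching E V M" unfolding matchable_def by blast
  then have edge: "match_edge E X" if "X \<in> M" for X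
    using perfect_matchingE[OF M that] unfolding match_edge_def by metis
  have part: "partition_on V M" using M unfolding perfect_matching_def by blast
  then have "M \<noteq> {}" using assms(4) partition_onD1 by blast
  then obtain X0 where "X0 \<in> M" by blast
  then show ?thesis using that[OF part] edge match_edge_supernode by blast
next
  assume crit: "odd (card V) \<and> factor_critical E V"
  obtain s where s: "s \<in> V" using assms(4) by blast
  then obtain M where M: "perfect_matching E (V - {s}) M"
    using crit unfolding factor_critical_def matchable_def by blast
  have edge: "match_edge E X" if "X \<in> M" for X
    using perfect_matchingE[OF M that] unfolding match_edge_def by metis
  have "partition_on ({s} \<union> (V - {s})) ({{s}} \<union> M)"
    using M unfolding perfect_matching_def by (intro partition_on_Un) (auto simp: partition_on_space)
  moreover have "{s} \<union> (V - {s}) = V" using s by blast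
  ultimately have "partition_on V ({{s}} \<union> M)" by simp
  moreover have "supernode E {s}" unfolding supernode_def by blast
  ultimately show ?thesis using that[of "{{s}} \<union> M" "{s}"] edge by blast
qed

text \<open>The cases are a factor-critical contracted graph, a perfectly matchable one, and one
  with more blocks than members of \<open>A\<close>. In the cases with a leftover piece,
  \<open>4 \<le> card V\<close> guarantees a four-node path that can absorb it.\<close>

theorem tough_path_cover:
  assumes "symp E" "finite V" and tough: "tough E V 0" and "4 \<le> card V"
  shows "\<exists>p. path_cover E V p \<and> 4 * p \<le> card V"
proof -
  have "V \<noteq> {}" using assms(4) by auto
  then obtain \<H> X0 where part: "partition_on V \<H>" and X0: "X0 \<in> \<H>" "supernode E X0"
    and edges: "\<And>X. X \<in> \<H> - {X0} \<Longrightarrow> match_edge E X"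
    using supernodes_exist[OF assms(2,1) tough] by metis
  have VH: "V = \<Union>\<H>" using part by (rule partition_onD1)
  have Hdisj: "X \<inter> Y = {}" if "X \<in> \<H>" "Y \<in> \<H>" "X \<noteq> Y" for X Y
    using disjointD[OF partition_onD2[OF part] that] .
  have finH: "finite \<H>" using finite_elements[OF assms(2) part] .
  have super: "supernode E X" if "X \<in> \<H>" for X
    using X0(2) edges[of X] that match_edge_supernode by (cases "X = X0") auto
  have card2: "card X = 2" if "match_edge E X" for X
    using that unfolding match_edge_def by auto
  have X0_card: "1 \<le> card X0" "card X0 \<le> 2"
    using X0(2) unfolding supernode_def by (auto simp: card_insert_if)
  have others: "match_edge E X" if "X \<in> \<H>" "X \<noteq> X0" for X using edges that by simp
  have cV: "card V = card X0 + 2 * card (\<H> - {X0})"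
  proof -
    have "card V = sum card \<H>" using card_partition_on[OF assms(2) part] .
    also have "\<dots> = card X0 + sum card (\<H> - {X0})" by (rule sum.remove[OF finH X0(1)])
    also have "sum card (\<H> - {X0}) = 2 * card (\<H> - {X0})" using card2 edges by simp
    finally show ?thesis .
  qed
  have cH: "card \<H> = Suc (card (\<H> - {X0}))" using card_Suc_Diff1[OF finH X0(1)] by simp
  obtain A \<K> g where A: "A \<subseteq> \<H>" "partition_on (\<H> - A) \<K>" "separated (contract E) \<K>"
    and crit: "\<And>K. K \<in> \<K> \<Longrightarrow> factor_critical (contract E) K"
    and g: "inj_on g A" "\<And>a. a \<in> A \<Longrightarrow> g a \<in> \<K> \<and> (\<exists>x\<in>g a. contract E a x)"
    using factor_critical_decomposition[OF finH symp_contract[OF assms(1)]] by metis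
  have HA: "\<H> - A = \<Union>\<K>" using A(2) by (rule partition_onD1)
  have fin\<K>: "finite \<K>" using finite_elements[OF finite_Diff[OF finH] A(2)] .
  have finA: "finite A" using A(1) finH finite_subset by blast
  have K_sub: "K \<subseteq> \<H> - A" if "K \<in> \<K>" for K using HA that by blast
  show ?thesis
  proof (cases "\<H> \<in> \<K>")
    \<comment> \<open>The whole contracted graph is factor-critical. Without \<open>X0\<close> it is
      matched into four-node paths, and \<open>X0\<close> is left over. Every node of
      \<open>X0\<close> can be an end, so \<open>P = X0\<close> and
      \<open>\<Q> = {X0}\<close>.\<close>
    case True
    show ?thesis
    proof (rule leftover_cover[OF assms(1,2) tough])
      show "disjoint (\<H> - {X0})" using Hdisj unfolding disjoint_def by blast
      show "matchable (contract E) (\<H> - {X0})"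
        using crit[OF True] X0(1) unfolding factor_critical_def by blast
      show "\<H> - {X0} \<noteq> {}"
      proof
        assume "\<H> - {X0} = {}"
        then have "card (\<H> - {X0}) = 0" by (simp only: card.empty)
        then show False using cV X0_card assms(4) by linarith
      qed
      show "X0 \<inter> \<Union>(\<H> - {X0}) = {}" using Hdisj[OF X0(1)] by blast
      show "V = \<Union>(\<H> - {X0}) \<union> X0" using VH X0(1) by blast
      show "attached E (X0 - {x}) x" if "x \<in> X0" for x using attached_Diff[OF assms(1) X0(2) that] .
      show "partition_on X0 {X0}" using X0_card(1) by (intro partition_on_space) auto
    qed (use edges in \<open>auto simp: separated_def\<close>)
  next
    case not_crit: False
    define U where "U = \<Union>A"
    define F where "F K = {u \<in> U. \<exists>X\<in>K. \<exists>x\<in>X. E x u}" for K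
    have finU: "finite U" using A(1) VH assms(2) unfolding U_def by (meson Union_mono finite_subset)
    have UV: "U \<subseteq> V" using A(1) VH unfolding U_def by blast
    have K_U: "X \<inter> U = {}" if "X \<in> K" "K \<in> \<K>" for X K
      using Hdisj[of X] K_sub[OF that(2)] that(1) A(1) unfolding U_def by blast
    have K_disj: "X \<inter> Y = {}" if "X \<in> K" "K \<in> \<K>" "Y \<in> L" "L \<in> \<K>" "K \<noteq> L" for X Y K L
    proof -
      have "K \<inter> L = {}" using disjointD[OF partition_onD2[OF A(2)] that(2,4,5)] .
      then have "X \<noteq> Y" using that by blast
      then show ?thesis using Hdisj[of X Y] K_sub that by blast
    qed
    have block_ne: "\<Union>K \<noteq> {}" if "K \<in> \<K>" for K
    proof -
      have "K \<noteq> {}" using that partition_onD3[OF A(2)] by blast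
      then obtain X where "X \<in> K" by blast
      moreover from this have "X \<in> \<H>" using K_sub[OF that] by blast
      then have "X \<noteq> {}" using super unfolding supernode_def by blast
      ultimately show ?thesis by blast
    qed
    \<comment> \<open>The blocks of \<open>J\<close>, seen as node sets, have all their outside
      neighbours in the part of \<open>U\<close> collected by \<open>F\<close>. Toughness with that
      part as \<open>W\<close> is Hall's condition. A block is a proper subset of \<open>V\<close>
      because the contracted graph is not a single block.\<close>
    have Hall: "card J \<le> card (\<Union>(F ` J))" if J: "J \<subseteq> \<K>" for J
    proof -
      have blocks_disj: "\<Union>K \<inter> \<Union>L = {}" if "K \<in> J" "L \<in> J" "K \<noteq> L" for K L
        using K_disj[of _ K _ L] that J by blast
      have inj: "inj_on Union J"
      proof (rule inj_onI)
        fix K L assume "K \<in> J" "L \<in> J" "\<Union>K = \<Union>L"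
        then show "K = L" using blocks_disj[of K L] block_ne[of K] J by (metis Int_absorb subsetD)
      qed
      have "card (Union ` J) \<le> card (\<Union>(F ` J)) + 0"
      proof (rule toughD[OF tough])
        show "\<Union>(F ` J) \<subseteq> V" using UV unfolding F_def by blast
        show "disjoint (Union ` J)"
          unfolding disjoint_def using blocks_disj by (metis imageE)
        show "B \<noteq> {}" if "B \<in> Union ` J" for B using that block_ne J by blast
        show "B \<inter> \<Union>(F ` J) = {}" if "B \<in> Union ` J" for B
          using that K_U J unfolding F_def by blast
        show "B \<subset> V" if B: "B \<in> Union ` J" for B
        proof -
          obtain K where K: "K \<in> J" "B = \<Union>K" using B by blast
          then have KK: "K \<in> \<K>" using J by blast
          have "K \<subseteq> \<H>" "K \<noteq> \<H>" using K_sub[OF KK] not_crit KK by blast+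
          then obtain X where X: "X \<in> \<H>" "X \<notin> K" by blast
          then have "X \<inter> Y = {}" if "Y \<in> K" for Y
            using Hdisj[of X Y] that \<open>K \<subseteq> \<H>\<close> by blast
          then have "X \<inter> B = {}" using K(2) by blast
          moreover have "X \<noteq> {}" "X \<subseteq> V" using super[OF X(1)] X(1) VH unfolding supernode_def by blast+
          moreover have "B \<subseteq> V" using \<open>K \<subseteq> \<H>\<close> K(2) VH by blast
          ultimately show ?thesis by blast
        qed
        fix B x y assume B: "B \<in> Union ` J" "x \<in> B" and y: "y \<in> V" "E x y" "y \<notin> \<Union>(F ` J)"
        obtain K X where K: "K \<in> J" "B = \<Union>K" "X \<in> K" "x \<in> X" using B by blast
        then have KK: "K \<in> \<K>" using J by blast
        have "y \<notin> U" using y(2,3) K unfolding F_def by blast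
        then obtain Y where Y: "Y \<in> \<H> - A" "y \<in> Y" using y(1) VH unfolding U_def by blast
        then obtain L where L: "L \<in> \<K>" "Y \<in> L" using HA by blast
        have "contract E X Y" using K(4) Y(2) y(2) unfolding contract_def by blast
        then have "K = L" using separatedD[OF A(3) KK L(1) _ K(3) L(2)] by blast
        then show "y \<in> B" using L(2) Y(2) K(2) by blast
      qed
      then show ?thesis using card_image[OF inj] by simp
    qed
    show ?thesis
    proof (cases "card \<K> \<le> card A")
      \<comment> \<open>As many blocks as members of \<open>A\<close>: the contracted graph has a
        perfect matching.\<close>
      case True
      have "g ` A \<subseteq> \<K>" using g(2) by blast
      then have "g ` A = \<K>" using True card_image[OF g(1)] card_seteq[OF fin\<K>] by simp
      then have "matchable (contract E) \<H>"
        using matchable_decomposition[OF finH A(1,2) crit g(1)] g(2) by blast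
      then obtain M where M: "perfect_matching (contract E) \<H> M" unfolding matchable_def by blast
      have cM: "card \<H> = 2 * card M" using perfect_matching_card[OF finH M] .
      show ?thesis
      proof (cases "card X0 = 2")
        case True
        have "path_cover E (\<Union>\<H>) (card M)"
          using path_cover_contracted_matching[OF assms(1) finH partition_onD2[OF part] super M] .
        moreover have "card V = 4 * card M" using cV cH cM True by linarith
        ultimately show ?thesis using VH by auto
      next
        case False
        then have "card X0 = 1" using X0_card by linarith
        then obtain s where s: "X0 = {s}" by (metis card_1_singletonE)
        have "X0 \<in> \<Union>M" using M X0(1) partition_onD1 unfolding perfect_matching_def by blast
        then obtain p where p: "p \<in> M" "X0 \<in> p" by blast
        obtain X Y where XY: "p = {X, Y}" "X \<noteq> Y" "contract E X Y" using perfect_matchingE[OF M p(1)] .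
        have "contract E Y X" using XY(3) symp_contract[OF assms(1)] by (meson sympD)
        then obtain Z where Z: "p = {X0, Z}" "X0 \<noteq> Z" "contract E X0 Z"
          using XY p(2) by (metis doubleton_eq_iff empty_iff insertE)
        have "p \<subseteq> \<H>" using p(1) M partition_onD1 unfolding perfect_matching_def by blast
        then have ZH: "Z \<in> \<H>" using Z(1) by blast
        obtain y where y: "y \<in> Z" "E s y" using Z(3) s unfolding contract_def by blast
        have "match_edge E Z" using others[OF ZH] Z(2) by blast
        then obtain z where z: "Z = {y, z}" "y \<noteq> z" "E y z"
          using y(1) assms(1) unfolding match_edge_def by (metis doubleton_eq_iff insertE singletonD sympD)
        have "X0 \<inter> Z = {}" using Hdisj[OF X0(1) ZH Z(2)] .
        then have dist: "s \<noteq> y" "s \<noteq> z" using s z(1) by auto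
        have sym: "E y s" "E z y" using y(2) z(3) assms(1) by (meson sympD)+
        \<comment> \<open>The single node \<open>s\<close> and its partner \<open>Z = {y, z}\<close>
          form the path \<open>s\<close>, \<open>y\<close>, \<open>z\<close>, the leftover piece.
          All other matched pairs give four-node paths.\<close>
        define Q where "Q = {s, y, z}"
        have Q: "Q = X0 \<union> Z" using s z(1) unfolding Q_def by auto
        have cQ: "card Q = 3" using dist z(2) unfolding Q_def by simp
        have minus: "Q - {s} = {z, y}" "Q - {z} = {s, y}" "Q - {y} = {z, s}"
          using dist z(2) unfolding Q_def by auto
        have "attached E (Q - {s}) s"
          unfolding attached_def minus using dist z(2) sym
          by (intro exI[of _ "[z, y]"]) (auto simp: is_path_def)
        moreover have "attached E (Q - {z}) z"
          unfolding attached_def minus using dist z(2,3) y(2)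
          by (intro exI[of _ "[s, y]"]) (auto simp: is_path_def)
        ultimately have ends: "attached E (Q - {s}) s" "attached E (Q - {z}) z" by simp_all
        have cover: ?thesis if PQ: "P \<subseteq> Q" "\<And>x. x \<in> P \<Longrightarrow> attached E (Q - {x}) x"
          "partition_on P \<Q>" "separated E \<Q>" "card (Q - P) < card \<Q>" for P \<Q>
        proof (rule leftover_cover[OF assms(1,2) tough _ _ _ _ _ _ PQ])
          show "disjoint (\<H> - p)" using Hdisj unfolding disjoint_def by blast
          show "match_edge E X" if "X \<in> \<H> - p" for X using that others p(2) by blast
          show "matchable (contract E) (\<H> - p)"
            using perfect_matching_remove[OF M p(1)] unfolding matchable_def by blast
          show "Q \<inter> \<Union>(\<H> - p) = {}"
            using Hdisj[OF X0(1)] Hdisj[OF ZH] unfolding Q Z(1) by blast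
          show VQ: "V = \<Union>(\<H> - p) \<union> Q" using VH X0(1) ZH unfolding Q Z(1) by blast
          show "\<H> - p \<noteq> {}"
          proof
            assume "\<H> - p = {}"
            with VQ have "V = Q" by (simp only: Union_empty Un_empty_left)
            then show False using cQ assms(4) by simp
          qed
        qed
        show ?thesis
        proof (cases "E s z")
          \<comment> \<open>A triangle: each of its nodes can be an end, so \<open>P = Q\<close> and
            no node of \<open>Q\<close> enters the toughness count.\<close>
          case True
          have "E z s" using True assms(1) by (meson sympD)
          have "attached E (Q - {y}) y"
            unfolding attached_def minus using dist z(2) y(2) \<open>E z s\<close>
            by (intro exI[of _ "[z, s]"]) (auto simp: is_path_def)
          then have "attached E (Q - {x}) x" if "x \<in> Q" for x
            using ends that unfolding Q_def by auto
          moreover have "Q \<noteq> {}" unfolding Q_def by simp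
          ultimately show ?thesis
            using cover[of Q "{Q}"] by (simp add: partition_on_space separated_def)
        next
          \<comment> \<open>Only \<open>s\<close> and \<open>z\<close> are used as ends. They are
            not adjacent, so they count as two pieces against the single node
            \<open>y\<close>.\<close>
          case False
          have "\<not> E z s" using False assms(1) by (meson sympD)
          have "Q - {s, z} = {y}" using dist z(2) unfolding Q_def by auto
          show ?thesis
          proof (rule cover[of "{s, z}" "{{s}, {z}}"])
            show "{s, z} \<subseteq> Q" unfolding Q_def by blast
            show "attached E (Q - {x}) x" if "x \<in> {s, z}" for x using that ends by blast
            show "partition_on {s, z} {{s}, {z}}"
              using dist by (auto simp: partition_on_def disjoint_def)
            show "separated E {{s}, {z}}" using False \<open>\<not> E z s\<close> unfolding separated_def by auto
            show "card (Q - {s, z}) < card {{s}, {z}}"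
              using \<open>Q - {s, z} = {y}\<close> dist(2) by simp
          qed
        qed
      qed
    next
      \<comment> \<open>More blocks than members of \<open>A\<close>: every block \<open>K\<close>
        sends one supernode \<open>B K\<close> as a tail to a node \<open>f K\<close> of
        \<open>U\<close>, different blocks to different nodes. The rest of \<open>K\<close> is
        matched by factor-criticality.\<close>
      case False
      have "\<exists>f. inj_on f \<K> \<and> (\<forall>K\<in>\<K>. f K \<in> F K)"
        by (rule hall[OF fin\<K> _ Hall]) (use finU in \<open>auto simp: F_def\<close>)
      then obtain f where f: "inj_on f \<K>" "\<forall>K\<in>\<K>. f K \<in> F K" by metis
      then have "\<forall>K\<in>\<K>. \<exists>X. X \<in> K \<and> (\<exists>x\<in>X. E x (f K))" unfolding F_def by blast
      then obtain B where B: "\<And>K. K \<in> \<K> \<Longrightarrow> B K \<in> K \<and> (\<exists>x\<in>B K. E x (f K))" by metis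
      have fU: "f K \<in> U" if "K \<in> \<K>" for K using f(2) that unfolding F_def by blast
      \<comment> \<open>Nodes of \<open>U\<close> that no block chooses receive the empty
        tail.\<close>
      define T where "T u = (if u \<in> f ` \<K> then B (the_inv_into \<K> f u) else {})" for u
      have Tf: "T (f K) = B K" if "K \<in> \<K>" for K
        using that the_inv_into_f_f[OF f(1) that] unfolding T_def by simp
      have T_out: "T u = {}" if "u \<notin> f ` \<K>" for u using that unfolding T_def by simp
      have BH: "B K \<in> \<H>" if "K \<in> \<K>" for K using B[OF that] K_sub[OF that] by blast
      have "path_cover E (U \<union> \<Union>(T ` U)) (card A)"
      proof (rule path_cover_attached[OF assms(1) finU])
        have "{} \<notin> A" using partition_onD3[OF part] A(1) by blast
        moreover have "disjoint A" using Hdisj A(1) unfolding disjoint_def by blast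
        ultimately show "partition_on U A" unfolding U_def partition_on_def by simp
        show "\<exists>x y. X = {x, y} \<and> (x = y \<or> E x y)" if "X \<in> A" for X
          using super[of X] that A(1) unfolding supernode_def by blast
        show "attached E (T u) u" if "u \<in> U" for u
        proof (cases "u \<in> f ` \<K>")
          case True
          then obtain K where K: "K \<in> \<K>" "u = f K" by blast
          then obtain x where x: "x \<in> B K" "E x u" using B by blast
          have "u \<notin> B K" using K_U[of "B K" K] B K(1) that by blast
          then show ?thesis
            using attached_extend[OF attached_Diff[OF assms(1) super[OF BH[OF K(1)]] x(1)] x] Tf[OF K(1)] K(2)
            by simp
        next
          case False
          then show ?thesis using T_out[OF False] unfolding attached_def by (intro exI[of _ "[]"]) simp
        qed
        show "T u \<inter> U = {}" if "u \<in> U" for u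
        proof (cases "u \<in> f ` \<K>")
          case True
          then obtain K where "K \<in> \<K>" "u = f K" by blast
          then show ?thesis using K_U[of "B K" K] B[of K] Tf[of K] by simp
        next
          case False
          then show ?thesis using T_out by simp
        qed
        show "disjoint_family_on T U"
          unfolding disjoint_family_on_def
        proof (intro ballI impI)
          fix u v assume uv: "u \<in> U" "v \<in> U" "u \<noteq> v"
          show "T u \<inter> T v = {}"
          proof (cases "u \<in> f ` \<K> \<and> v \<in> f ` \<K>")
            case True
            then obtain K L where KL: "K \<in> \<K>" "u = f K" "L \<in> \<K>" "v = f L" by blast
            then have "K \<noteq> L" using uv(3) by blast
            then show ?thesis using K_disj[of "B K" K "B L" L] B KL Tf by simp
          next
            case False
            then show ?thesis using T_out by blast
          qed
        qed
      qed
      moreover have TU: "\<Union>(T ` U) = (\<Union>K\<in>\<K>. B K)"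
      proof -
        have "T u \<subseteq> (\<Union>K\<in>\<K>. B K)" for u
          using Tf T_out by (cases "u \<in> f ` \<K>") auto
        moreover have "B K \<subseteq> \<Union>(T ` U)" if "K \<in> \<K>" for K using Tf[OF that] fU[OF that] by blast
        ultimately show ?thesis by blast
      qed
      ultimately have first: "path_cover E (U \<union> (\<Union>K\<in>\<K>. B K)) (card A)" by simp
      define k where "k K = (card K - 1) div 2" for K :: "'a set set"
      have "path_cover E (\<Union>K\<in>\<K>. \<Union>(K - {B K})) (\<Sum>K\<in>\<K>. k K) \<and> (\<forall>K\<in>\<K>. card K = 2 * k K + 1)"
      proof -
        have each: "path_cover E (\<Union>(K - {B K})) (k K) \<and> card K = 2 * k K + 1" if K: "K \<in> \<K>" for K
        proof -
          have KH: "K \<subseteq> \<H>" using K_sub[OF K] by blast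
          have finK: "finite K" using KH finH finite_subset by blast
          obtain M where M: "perfect_matching (contract E) (K - {B K}) M"
            using crit[OF K] B[OF K] unfolding factor_critical_def matchable_def by blast
          have "path_cover E (\<Union>(K - {B K})) (card M)"
          proof (rule path_cover_contracted_matching[OF assms(1) _ _ _ M])
            show "finite (K - {B K})" using finK by simp
            show "disjoint (K - {B K})" using Hdisj KH unfolding disjoint_def by blast
            show "supernode E X" if "X \<in> K - {B K}" for X using super that KH by blast
          qed
          moreover have "card (K - {B K}) = 2 * card M"
            using perfect_matching_card[OF _ M] finK by simp
          moreover have "Suc (card (K - {B K})) = card K" using card_Suc_Diff1[OF finK] B[OF K] by blast
          ultimately have "path_cover E (\<Union>(K - {B K})) (card M) \<and> card K = 2 * card M + 1" by simp
          moreover from this have "k K = card M" unfolding k_def by simp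
          ultimately show ?thesis by simp
        qed
        moreover have "disjoint_family_on (\<lambda>K. \<Union>(K - {B K})) \<K>"
          unfolding disjoint_family_on_def using K_disj by blast
        ultimately show ?thesis using path_cover_UN[OF fin\<K>, of E "\<lambda>K. \<Union>(K - {B K})" k] by blast
      qed
      then have rest: "path_cover E (\<Union>K\<in>\<K>. \<Union>(K - {B K})) (\<Sum>K\<in>\<K>. k K)"
        and kK: "\<And>K. K \<in> \<K> \<Longrightarrow> card K = 2 * k K + 1" by blast+
      have "(U \<union> (\<Union>K\<in>\<K>. B K)) \<inter> (\<Union>K\<in>\<K>. \<Union>(K - {B K})) = {}"
      proof -
        have "U \<inter> \<Union>(K - {B K}) = {}" if "K \<in> \<K>" for K using K_U[OF _ that] by blast
        moreover have "B L \<inter> \<Union>(K - {B K}) = {}" if "K \<in> \<K>" "L \<in> \<K>" for K L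
        proof (cases "K = L")
          case True
          then show ?thesis using Hdisj[OF BH[OF that(2)]] K_sub[OF that(1)] by blast
        next
          case False
          then show ?thesis using K_disj[OF _ that(2) _ that(1)] B[OF that(2)] by blast
        qed
        ultimately show ?thesis by blast
      qed
      from path_cover_Un[OF first rest this]
      have "path_cover E ((U \<union> (\<Union>K\<in>\<K>. B K)) \<union> (\<Union>K\<in>\<K>. \<Union>(K - {B K}))) (card A + (\<Sum>K\<in>\<K>. k K))" .
      moreover have "(U \<union> (\<Union>K\<in>\<K>. B K)) \<union> (\<Union>K\<in>\<K>. \<Union>(K - {B K})) = V"
      proof -
        have "B K \<union> \<Union>(K - {B K}) = \<Union>K" if "K \<in> \<K>" for K using B[OF that] by blast
        then have "(\<Union>K\<in>\<K>. B K) \<union> (\<Union>K\<in>\<K>. \<Union>(K - {B K})) = \<Union>(\<Union>\<K>)" by blast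
        moreover have "\<H> = A \<union> (\<H> - A)" using A(1) by blast
        then have "V = U \<union> \<Union>(\<Union>\<K>)" unfolding VH U_def HA[symmetric] by blast
        ultimately show ?thesis by blast
      qed
      \<comment> \<open>The supernodes number
        \<open>card A + 2 * (\<Sum>K\<in>\<K>. k K) + card \<K>\<close>, and
        \<open>card \<K>\<close> is at least \<open>card A + 1\<close>. This surplus of one pays for
        \<open>X0\<close>, which may have only one node; each other supernode contributes
        two.\<close>
      moreover have "4 * (card A + (\<Sum>K\<in>\<K>. k K)) \<le> card V"
      proof -
        have "card (\<H> - A) = sum card \<K>" using card_partition_on[OF _ A(2)] finH by simp
        also have "\<dots> = (\<Sum>K\<in>\<K>. 2 * k K + 1)" using kK by (intro sum.cong) auto
        also have "\<dots> = 2 * (\<Sum>K\<in>\<K>. k K) + card \<K>"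
          unfolding sum.distrib sum_distrib_left by simp
        finally have "card (\<H> - A) = 2 * (\<Sum>K\<in>\<K>. k K) + card \<K>" .
        moreover have "card \<H> = card A + card (\<H> - A)"
          using card_Un_disjoint[of A "\<H> - A"] finA finH A(1) by (simp add: Un_absorb1)
        moreover have "Suc (card A) \<le> card \<K>" using False by simp
        moreover have "d = 2 * \<kappa> + c \<Longrightarrow> h = a + d \<Longrightarrow> Suc a \<le> c \<Longrightarrow> h = Suc m \<Longrightarrow> 4 * (a + \<kappa>) \<le> 2 * m"
          for a c d h \<kappa> m :: nat by simp
        ultimately have "4 * (card A + (\<Sum>K\<in>\<K>. k K)) \<le> 2 * card (\<H> - {X0})" using cH by metis
        then show ?thesis using cV by linarith
      qed
      ultimately show ?thesis by auto
    qed
  qed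
qed

section \<open>Universal nodes\<close>

lemma path_cover_add:
  assumes "path_cover E V k" "is_path E xs" "set xs \<inter> V = {}"
  shows "\<exists>q\<le>Suc k. path_cover E (set xs \<union> V) q"
proof (cases "xs = []")
  case True
  then show ?thesis using assms(1) by (intro exI[of _ k]) simp
next
  case False
  then show ?thesis using path_cover.add_path[OF assms(1) False assms(2,3)] by blast
qed

text \<open>The deleted node lies on at most one path, which it cuts in two.\<close>

lemma path_cover_remove1:
  assumes "path_cover E V k" shows "\<exists>q\<le>Suc k. path_cover E (V - {v}) q"
  using assms
proof (induction rule: path_cover.induct)
  case empty
  then show ?case using path_cover.empty[of E] by auto
next
  case (add_path V k xs)
  show ?case
  proof (cases "v \<in> set xs")
    case True
    \<comment> \<open>Either half may be empty and then counts as no path, hence only an upper bound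
      on the number of paths.\<close>
    then obtain ys zs where xs: "xs = ys @ v # zs" by (metis split_list)
    have "is_path E (ys @ ([v] @ zs))" using add_path.hyps xs by simp
    then have paths: "is_path E ys" "is_path E zs" and sets: "v \<notin> set ys" "v \<notin> set zs" "set ys \<inter> set zs = {}"
      unfolding is_path_append by auto
    have "set zs \<inter> V = {}" using add_path.hyps xs by auto
    then obtain q where q: "q \<le> Suc k" "path_cover E (set zs \<union> V) q"
      using path_cover_add[OF add_path.hyps(1) paths(2)] by blast
    have "set ys \<inter> (set zs \<union> V) = {}" using add_path.hyps xs sets by auto
    then obtain r where r: "r \<le> Suc q" "path_cover E (set ys \<union> (set zs \<union> V)) r"
      using path_cover_add[OF q(2) paths(1)] by blast
    have "v \<notin> V" using True add_path.hyps by blast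
    then have "set xs \<union> V - {v} = set ys \<union> (set zs \<union> V)" using xs sets by auto
    then show ?thesis using r q(1) by (intro exI[of _ r]) simp
  next
    case False
    obtain q where q: "q \<le> Suc k" "path_cover E (V - {v}) q" using add_path.IH by blast
    have "path_cover E (set xs \<union> (V - {v})) (Suc q)"
      using add_path.hyps by (intro path_cover.add_path[OF q(2)]) auto
    moreover have "set xs \<union> V - {v} = set xs \<union> (V - {v})" using False by blast
    ultimately show ?thesis using q(1) by (intro exI[of _ "Suc q"]) simp
  qed
qed

lemma path_cover_Diff:
  assumes "finite R" "path_cover E V k" shows "\<exists>q\<le>k + card R. path_cover E (V - R) q"
  using assms(1)
proof (induction R rule: finite_induct)
  case empty
  then show ?case using assms(2) by auto
next
  case (insert v R)
  then obtain q where q: "q \<le> k + card R" "path_cover E (V - R) q" by blast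
  obtain r where "r \<le> Suc q" "path_cover E (V - R - {v}) r" using path_cover_remove1[OF q(2)] by blast
  moreover have "V - insert v R = V - R - {v}" by blast
  moreover have "card (insert v R) = Suc (card R)" using insert.hyps by simp
  ultimately show ?case using q(1) by (intro exI[of _ r]) simp
qed

text \<open>The nodes \<open>Inr i\<close> are adjacent to everything, including themselves; loops are
  harmless because paths are distinct lists.\<close>

fun add_universal :: "('a \<Rightarrow> 'a \<Rightarrow> bool) \<Rightarrow> 'a + 'b \<Rightarrow> 'a + 'b \<Rightarrow> bool" where
  "add_universal E (Inl x) (Inl y) = E x y"
| "add_universal E _ _ = True"

lemma symp_add_universal:
  assumes "symp E" shows "symp (add_universal E)"
proof (rule sympI)
  fix x y :: "'a + 'b" assume "add_universal E x y"
  then show "add_universal E y x" using assms by (cases x; cases y) (auto dest: sympD)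
qed

lemma path_cover_vimage_Inl:
  assumes "path_cover (add_universal E) W k" "W \<subseteq> range Inl"
  shows "path_cover E (Inl -` W) k"
  using assms
proof (induction rule: path_cover.induct)
  case empty
  then show ?case by (simp add: path_cover.empty)
next
  case (add_path W k xs)
  then obtain ys where ys: "xs = map Inl ys"
    by (metis Un_subset_iff ex_map_conv image_iff subsetD)
  have "successively E ys" "distinct ys"
    using add_path.hyps ys unfolding is_path_def by (auto simp: successively_map distinct_map)
  moreover have "set ys \<inter> Inl -` W = {}" using add_path.hyps ys by auto
  ultimately have "path_cover E (set ys \<union> Inl -` W) (Suc k)"
    using add_path ys by (intro path_cover.add_path) (auto simp: is_path_def)
  moreover have "Inl -` (set xs \<union> W) = set ys \<union> Inl -` W" using ys by auto
  ultimately show ?case by simp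
qed

text \<open>A block with a node adjacent to everything contains all nodes outside \<open>W\<close>;
  it is then the only block, and \<open>W\<close> is nonempty as the block is proper. Otherwise all
  blocks lie in \<open>Inl\<close>
  V\<open>, and their universal neighbours must be in\<close>W\<open>, which provides the additional\<close>t\<open>. The single block\<close>Inl
  \<open>V\<close> is treated separately because it is not a proper subset of the original nodes;
  there \<open>t\<close> is positive.\<close>

lemma tough_add_universal:
  assumes "finite V" "tough E V t"
  shows "tough (add_universal E) (Inl ` V \<union> Inr ` {..<t}) 0"
  unfolding tough_def
proof (intro allI impI, elim conjE)
  let ?V = "Inl ` V \<union> Inr ` {..<t}" and ?E = "add_universal E"
  fix W :: "('a + nat) set" and \<K>
  assume W: "W \<subseteq> ?V" and disj: "disjoint \<K>"
    and all: "\<forall>K\<in>\<K>. K \<noteq> {} \<and> K \<subset> ?V \<and> K \<inter> W = {} \<and> (\<forall>x\<in>K. \<forall>y\<in>?V. ?E x y \<longrightarrow> y \<in> K \<union> W)"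
  have K: "K \<noteq> {}" "K \<subset> ?V" "K \<inter> W = {}" if "K \<in> \<K>" for K using bspec[OF all that] by simp_all
  have closed: "y \<in> K \<union> W" if "K \<in> \<K>" "x \<in> K" "y \<in> ?V" "?E x y" for K x y
    using bspec[OF all that(1)] that(2-4) by metis
  have finV: "finite ?V" using assms(1) by simp
  have finW: "finite W" using W finV finite_subset by blast
  show "card \<K> \<le> card W + 0"
  proof (cases "\<exists>K\<in>\<K>. \<exists>x\<in>K. \<forall>y. ?E x y")
    case True
    then obtain K x where Kx: "K \<in> \<K>" "x \<in> K" "\<And>y. ?E x y" by blast
    then have VK: "?V \<subseteq> K \<union> W" using closed by blast
    have "\<K> \<subseteq> {K}"
    proof
      fix L assume L: "L \<in> \<K>"
      then have "L \<inter> K \<noteq> {}" using K[OF L] VK by blast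
      then show "L \<in> {K}" using disjointD[OF disj L Kx(1)] by blast
    qed
    then have "card \<K> \<le> 1" using card_mono[of "{K}" \<K>] by simp
    moreover have "W \<noteq> {}" using VK K(2)[OF Kx(1)] by blast
    then have "1 \<le> card W" using finW by (simp add: Suc_leI card_gt_0_iff)
    ultimately show ?thesis by linarith
  next
    case no_univ: False
    have inl: "K \<subseteq> Inl ` V" if "K \<in> \<K>" for K
    proof
      fix x assume x: "x \<in> K"
      have "x \<noteq> Inr i" for i
      proof
        assume "x = Inr i"
        moreover have "?E (Inr i) y" for y by (cases y) simp_all
        ultimately show False using no_univ that x by blast
      qed
      then show "x \<in> Inl ` V" using K(2)[OF that] x by blast
    qed
    show ?thesis
    proof (cases "\<K> = {}")
      case False
      then obtain K0 x0 where K0: "K0 \<in> \<K>" "x0 \<in> K0" using K(1) by blast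
      then obtain v0 where v0: "x0 = Inl v0" using inl by blast
      have univ_W: "Inr ` {..<t} \<subseteq> W"
      proof
        fix y :: "'a + nat" assume y: "y \<in> Inr ` {..<t}"
        then have "?E x0 y" using v0 by auto
        then have "y \<in> K0 \<union> W" using closed[OF K0] y by blast
        then show "y \<in> W" using inl[OF K0(1)] y by blast
      qed
      define W' where "W' = Inl -` W"
      have "W = Inl ` W' \<union> Inr ` {..<t}" using W univ_W unfolding W'_def by auto
      moreover have "finite (Inl ` W' :: ('a + nat) set)"
        using finW calculation by (metis finite_Un)
      ultimately have "card W = card (Inl ` W' :: ('a + nat) set) + card (Inr ` {..<t} :: ('a + nat) set)"
        by (simp only:) (intro card_Un_disjoint; auto)
      then have cW: "card W = card W' + t" by (simp add: card_image)
      show ?thesis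
      proof (cases "Inl ` V \<in> \<K>")
        case True
        have "\<K> \<subseteq> {Inl ` V}"
        proof
          fix L assume L: "L \<in> \<K>"
          then have "L \<inter> Inl ` V \<noteq> {}" using K(1)[OF L] inl[OF L] by blast
          then show "L \<in> {Inl ` V}" using disjointD[OF disj L True] by blast
        qed
        then have "card \<K> \<le> 1" using card_mono[of "{Inl ` V}" \<K>] by simp
        moreover have "t \<noteq> 0" using K(2)[OF True] by (intro notI) simp
        ultimately show ?thesis using cW by linarith
      next
        case False
        have Inl_K: "Inl ` (Inl -` K) = K" if "K \<in> \<K>" for K :: "('a + nat) set"
          using inl[OF that] by blast
        have inj: "inj_on (vimage Inl) \<K>" using Inl_K by (metis inj_onI)
        have "card (vimage Inl ` \<K>) \<le> card W' + t"
        proof (rule toughD[OF assms(2)])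
          show "W' \<subseteq> V" using W unfolding W'_def by auto
          show "disjoint (vimage Inl ` \<K>)"
            unfolding disjoint_def
          proof (intro ballI impI)
            fix B B' assume "B \<in> vimage Inl ` \<K>" "B' \<in> vimage Inl ` \<K>" "B \<noteq> B'"
            then obtain K L where "K \<in> \<K>" "L \<in> \<K>" "B = Inl -` K" "B' = Inl -` L" "K \<noteq> L" by blast
            then show "B \<inter> B' = {}" using disjointD[OF disj, of K L] by (simp flip: vimage_Int)
          qed
          fix B assume "B \<in> vimage Inl ` \<K>"
          then obtain K where KB: "K \<in> \<K>" "B = Inl -` K" by blast
          show "B \<noteq> {}" using Inl_K[OF KB(1)] K(1)[OF KB(1)] KB(2) by (metis image_empty)
          show "B \<inter> W' = {}" using K(3)[OF KB(1)] KB(2) unfolding W'_def by auto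
          have "K \<noteq> Inl ` V" using False KB(1) by blast
          then show "B \<subset> V" using inl[OF KB(1)] Inl_K[OF KB(1)] KB(2) by auto
          show "y \<in> B" if "x \<in> B" "y \<in> V" "E x y" "y \<notin> W'" for x y
            using closed[OF KB(1), of "Inl x" "Inl y"] that KB(2) unfolding W'_def by auto
        qed
        then show ?thesis using card_image[OF inj] cW by simp
      qed
    qed simp
  qed
qed

text \<open>The enlarged graph has \<open>card V + t\<close> nodes, and deleting the universal nodes
  adds at most \<open>t\<close> paths. Hence the term \<open>5 * t\<close>, composed of
  \<open>t\<close> and \<open>4 * t\<close>.\<close>

theorem tough_path_cover_defect:
  assumes "symp E" "finite V" "tough E V t" "4 \<le> card V"
  shows "\<exists>p. path_cover E V p \<and> 4 * p \<le> card V + 5 * t"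
proof -
  let ?V = "Inl ` V \<union> Inr ` {..<t} :: ('a + nat) set"
  have cV: "card ?V = card V + t"
    using assms(2) by (subst card_Un_disjoint) (auto simp: card_image)
  obtain p where p: "path_cover (add_universal E) ?V p" "4 * p \<le> card V + t"
    using tough_path_cover[OF symp_add_universal[OF assms(1)] _ tough_add_universal[OF assms(2,3)]]
      assms(2,4) cV by auto
  obtain q where q: "q \<le> p + card (Inr ` {..<t} :: ('a + nat) set)"
    "path_cover (add_universal E) (?V - Inr ` {..<t}) q"
    using path_cover_Diff[OF _ p(1)] by (metis finite_imageI finite_lessThan)
  have "?V - Inr ` {..<t} = Inl ` V" by auto
  then have "path_cover E (Inl -` (Inl ` V :: ('a + nat) set)) q"
    using q(2) by (intro path_cover_vimage_Inl) auto
  moreover have "Inl -` (Inl ` V :: ('a + nat) set) = V" by auto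
  moreover have "q \<le> p + t" using q(1) by (simp add: card_image)
  ultimately show ?thesis using p(2) by (intro exI[of _ q]) auto
qed

section \<open>Tours and the subtour LP\<close>

fun walk_cost :: "('a set \<Rightarrow> real) \<Rightarrow> 'a list \<Rightarrow> real" where
  "walk_cost c (x # y # zs) = c {x, y} + walk_cost c (y # zs)"
| "walk_cost c _ = 0"

lemma walk_cost_append:
  "xs \<noteq> [] \<Longrightarrow> ys \<noteq> [] \<Longrightarrow> walk_cost c (xs @ ys) = walk_cost c xs + c {last xs, hd ys} + walk_cost c ys"
proof (induction xs rule: induct_list012)
  case (2 x)
  then show ?case by (cases ys) auto
qed auto

lemma walk_cost_eq_sum: "walk_cost c xs = (\<Sum>i<length xs - 1. c {xs ! i, xs ! Suc i})"
proof (induction c xs rule: walk_cost.induct)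
  case (1 c x y zs)
  then show ?case by (simp add: sum.lessThan_Suc_shift del: sum.lessThan_Suc)
qed auto

text \<open>\<open>one_two_costs\<close> does not constrain \<open>c {x, x}\<close>, so loops are
  excluded explicitly.\<close>

definition unit_edge :: "('a set \<Rightarrow> real) \<Rightarrow> 'a \<Rightarrow> 'a \<Rightarrow> bool" where
  "unit_edge c x y \<longleftrightarrow> x \<noteq> y \<and> c {x, y} = 1"

lemma symp_unit_edge: "symp (unit_edge c)"
  unfolding unit_edge_def by (intro sympI) (auto simp: insert_commute)

lemma walk_cost_path: "xs \<noteq> [] \<Longrightarrow> is_path (unit_edge c) xs \<Longrightarrow> walk_cost c xs = real (length xs) - 1"
  by (induction c xs rule: walk_cost.induct) (auto simp: is_path_def unit_edge_def)

lemma edge_cost_cases: "one_two_costs V c \<Longrightarrow> u \<in> V \<Longrightarrow> v \<in> V \<Longrightarrow> u \<noteq> v \<Longrightarrow> c {u, v} \<in> {1, 2}"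
  unfolding one_two_costs_def complete_edges_def by auto

text \<open>Concatenating \<open>k\<close> paths uses \<open>card V - k\<close> unit edges and
  \<open>k - 1\<close> joining edges of cost at most 2.\<close>

lemma path_cover_walk:
  assumes "path_cover (unit_edge c) V k" "one_two_costs V c" "V \<noteq> {}"
  shows "\<exists>xs. distinct xs \<and> set xs = V \<and> walk_cost c xs \<le> real (card V) + real k - 2"
  using assms
proof (induction rule: path_cover.induct)
  case (add_path V k xs)
  have dist: "distinct xs" using add_path.hyps unfolding is_path_def by blast
  have w: "walk_cost c xs = real (card (set xs)) - 1"
    using walk_cost_path[OF add_path.hyps(2,3)] distinct_card[OF dist] by simp
  show ?case
  proof (cases "V = {}")
    case True
    then show ?thesis using dist w by (intro exI[of _ xs]) simp
  next
    case False
    have "one_two_costs V c"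
      using add_path.prems(1) unfolding one_two_costs_def complete_edges_def by blast
    then obtain ys where ys: "distinct ys" "set ys = V" "walk_cost c ys \<le> real (card V) + real k - 2"
      using add_path.IH False by blast
    have ne: "ys \<noteq> []" using ys(2) False by auto
    have in_V: "last xs \<in> set xs" "hd ys \<in> V" using add_path.hyps(2) ne ys(2) by auto
    then have "last xs \<noteq> hd ys" using add_path.hyps(4) by (metis disjoint_iff)
    then have "c {last xs, hd ys} \<le> 2" using edge_cost_cases[OF add_path.prems(1), of "last xs" "hd ys"] in_V by auto
    then have "walk_cost c (xs @ ys) \<le> real (card (set xs)) + real (card V) + real (Suc k) - 2"
      using walk_cost_append[OF add_path.hyps(2) ne] w ys(3) by simp
    moreover have "card (set xs \<union> V) = card (set xs) + card V"
      using add_path.hyps(4) ys(2) by (intro card_Un_disjoint) auto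
    moreover have "distinct (xs @ ys)" using dist ys add_path.hyps(4) by auto
    ultimately show ?thesis using ys(2) by (intro exI[of _ "xs @ ys"]) simp
  qed
qed simp

lemma cycle_edges_subset:
  assumes "distinct vs" "3 \<le> length vs"
  shows "cycle_edges vs \<subseteq> complete_edges (set vs)"
proof
  fix e assume "e \<in> cycle_edges vs"
  then obtain i where i: "i < length vs" "e = {vs ! i, vs ! (Suc i mod length vs)}"
    unfolding cycle_edges_def by blast
  have lt: "Suc i mod length vs < length vs" using assms(2) by (intro mod_less_divisor) linarith
  have "Suc i mod length vs \<noteq> i"
    using i(1) assms(2) by (cases "Suc i = length vs") auto
  then have "vs ! i \<noteq> vs ! (Suc i mod length vs)"
    using nth_eq_iff_index_eq[OF assms(1) i(1) lt] by simp
  then show "e \<in> complete_edges (set vs)" using i lt unfolding complete_edges_def by auto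
qed

lemma cost_bounds:
  assumes "one_two_costs V c" "e \<in> complete_edges V" shows "1 \<le> c e" "c e \<le> 2"
  using assms unfolding one_two_costs_def by force+

lemma min_tour_le_walk:
  assumes "finite V" "one_two_costs V c" "3 \<le> card V" "distinct vs" "set vs = V"
  shows "min_tour_cost V c \<le> walk_cost c vs + 2"
proof -
  define f where "f i = {vs ! i, vs ! (Suc i mod length vs)}" for i
  have len: "3 \<le> length vs" using assms(3-5) distinct_card by metis
  have ce: "cycle_edges vs = f ` {..<length vs}" unfolding cycle_edges_def f_def by auto
  have edges: "f i \<in> complete_edges V" if "i < length vs" for i
    using cycle_edges_subset[OF assms(4) len] assms(5) that unfolding ce by auto
  have "cycle_edges vs \<in> hamiltonian_cycles V"
    using assms(4,5) len unfolding hamiltonian_cycles_def by blast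
  then have "min_tour_cost V c \<le> edge_cost c (cycle_edges vs)"
    unfolding min_tour_cost_def using finite_hamiltonian_cycles[OF assms(1)] by (intro Min_le) auto
  \<comment> \<open>Costs on edges are nonnegative, so the sum over the image of \<open>f\<close> is
    bounded by the sum over the indices, whether or not \<open>f\<close> is injective.\<close>
  also have "\<dots> \<le> (\<Sum>i<length vs. c (f i))"
    unfolding edge_cost_def ce using sum_image_le[of "{..<length vs}" c f] edges cost_bounds[OF assms(2)]
    by (force simp: o_def)
  also obtain m where m: "length vs = Suc m" using len by (cases "length vs") auto
  then have "(\<Sum>i<length vs. c (f i)) = (\<Sum>i<m. c (f i)) + c (f m)" by simp
  also have "(\<Sum>i<m. c (f i)) = walk_cost c vs"
    unfolding walk_cost_eq_sum m by (intro sum.cong) (auto simp: f_def m)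
  also have "c (f m) \<le> 2" using cost_bounds(2)[OF assms(2) edges] m by simp
  finally show ?thesis by simp
qed

section \<open>Cuts of feasible points and toughness\<close>

lemma sum_cuts:
  assumes "finite V" "finite I"
  shows "(\<Sum>i\<in>I. \<Sum>e\<in>cut_edges V (S i). x e) =
    (\<Sum>e\<in>complete_edges V. real (card {i \<in> I. card (e \<inter> S i) = 1}) * x e)"
proof -
  note fin = finite_complete_edges[OF assms(1)]
  have "(\<Sum>i\<in>I. \<Sum>e\<in>cut_edges V (S i). x e) =
      (\<Sum>i\<in>I. \<Sum>e\<in>complete_edges V. if card (e \<inter> S i) = 1 then x e else 0)"
    unfolding cut_edges_def by (intro sum.cong[OF refl] sum.inter_filter[OF fin])
  also have "\<dots> = (\<Sum>e\<in>complete_edges V. \<Sum>i\<in>I. if card (e \<inter> S i) = 1 then x e else 0)"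
    by (rule sum.swap)
  also have "\<dots> = (\<Sum>e\<in>complete_edges V. real (card {i \<in> I. card (e \<inter> S i) = 1}) * x e)"
    by (intro sum.cong[OF refl]) (simp add: sum.inter_filter[OF assms(2), symmetric])
  finally show ?thesis .
qed

lemma cut_edges_Compl: "S \<subseteq> V \<Longrightarrow> cut_edges V (V - S) = cut_edges V S"
proof -
  assume "S \<subseteq> V"
  have "card (e \<inter> (V - S)) = 1 \<longleftrightarrow> card (e \<inter> S) = 1" if "e \<in> complete_edges V" for e
  proof -
    have e: "e \<subseteq> V" "card e = 2" "finite e"
      using that card_ge_0_finite[of e] unfolding complete_edges_def by auto
    have "e = (e \<inter> S) \<union> (e \<inter> (V - S))" using e(1) by blast
    then have "card e = card (e \<inter> S) + card (e \<inter> (V - S))"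
      using e(3) card_Un_disjoint[of "e \<inter> S" "e \<inter> (V - S)"] by auto
    then show ?thesis using e(2) by linarith
  qed
  then show ?thesis unfolding cut_edges_def by blast
qed

text \<open>Supplies the set sizes that the subtour constraints omit. For a pair
  \<open>{u, v}\<close> the two degrees add up to 4, and the edge between the nodes takes away
  \<open>2 * x {u, v}\<close>, which is at most 2.\<close>

lemma small_cut_ge_2:
  assumes "finite V" "subtour_feasible V x" "S \<subset> V" "S \<noteq> {}" "card S \<le> 2"
  shows "2 \<le> (\<Sum>e\<in>cut_edges V S. x e)"
proof -
  have deg: "(\<Sum>e\<in>cut_edges V {i}. x e) = 2" if "i \<in> V" for i
    using assms(2) that unfolding subtour_feasible_def by blast
  have finS: "finite S" using assms(1,3) finite_subset by blast
  have "card S \<noteq> 0" using finS assms(4) by simp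
  then consider "card S = 1" | "card S = 2" using assms(5) by linarith
  then show ?thesis
  proof cases
    case 1
    then obtain i where "S = {i}" by (metis card_1_singletonE)
    then show ?thesis using deg[of i] assms(3) by auto
  next
    case 2
    then obtain u v where uv: "S = {u, v}" "u \<noteq> v" by (auto simp: card_2_iff)
    have "{u, v} \<in> complete_edges V" using uv assms(3) unfolding complete_edges_def by auto
    then have uv1: "x {u, v} \<le> 1" using assms(2) unfolding subtour_feasible_def by blast
    have fin: "finite (cut_edges V T)" for T
      using finite_complete_edges[OF assms(1)] unfolding cut_edges_def by simp
    have cut1: "e \<in> cut_edges V {i} \<longleftrightarrow> e \<in> complete_edges V \<and> i \<in> e" for e i
      unfolding cut_edges_def by (cases "i \<in> e") auto
    have cut2: "e \<in> cut_edges V S \<longleftrightarrow> e \<in> complete_edges V \<and> (u \<in> e \<longleftrightarrow> v \<notin> e)" for e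
    proof -
      have "card (e \<inter> S) = 1 \<longleftrightarrow> (u \<in> e \<longleftrightarrow> v \<notin> e)"
        using uv by (cases "u \<in> e"; cases "v \<in> e") (auto simp: Int_insert_right)
      then show ?thesis unfolding cut_edges_def by blast
    qed
    have both: "e = {u, v}" if "e \<in> complete_edges V" "u \<in> e" "v \<in> e" for e
      using that uv(2) unfolding complete_edges_def by (auto simp: card_2_iff)
    have split: "(\<Sum>e\<in>cut_edges V {w}. x e) = (\<Sum>e\<in>cut_edges V {w} - {{u, v}}. x e) + x {u, v}"
      if "w \<in> {u, v}" for w
    proof -
      have "{u, v} \<in> cut_edges V {w}"
        using that \<open>{u, v} \<in> complete_edges V\<close> unfolding cut1 by auto
      from sum.remove[OF fin this, of x] show ?thesis by simp
    qed
    have "cut_edges V S = (cut_edges V {u} - {{u, v}}) \<union> (cut_edges V {v} - {{u, v}})"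
      unfolding set_eq_iff Un_iff Diff_iff cut1 cut2 using both by blast
    moreover have "(cut_edges V {u} - {{u, v}}) \<inter> (cut_edges V {v} - {{u, v}}) = {}"
      unfolding set_eq_iff Int_iff Diff_iff cut1 using both by blast
    ultimately have "(\<Sum>e\<in>cut_edges V S. x e) =
        (\<Sum>e\<in>cut_edges V {u} - {{u, v}}. x e) + (\<Sum>e\<in>cut_edges V {v} - {{u, v}}. x e)"
      using fin by (simp add: sum.union_disjoint)
    moreover have "u \<in> V" "v \<in> V" using uv assms(3) by auto
    ultimately show ?thesis using split[of u] split[of v] deg[of u] deg[of v] uv1 by simp
  qed
qed

text \<open>A set that is too large for the subtour constraints has a small complement with the same
  cut.\<close>

lemma cut_ge_2:
  assumes "finite V" "subtour_feasible V x" "S \<subset> V" "S \<noteq> {}"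
  shows "2 \<le> (\<Sum>e\<in>cut_edges V S. x e)"
proof -
  have card: "card (V - S) + card S = card V"
    using assms(1,3) card_Diff_subset[of S V] card_mono[of V S] finite_subset[of S V] by auto
  consider "card S \<le> 2" | "card (V - S) \<le> 2" | "3 \<le> card S \<and> card S + 3 \<le> card V"
    using card by linarith
  then show ?thesis
  proof cases
    case 1
    then show ?thesis using small_cut_ge_2[OF assms] by blast
  next
    case 2
    then have "2 \<le> (\<Sum>e\<in>cut_edges V (V - S). x e)"
      using assms(3,4) by (intro small_cut_ge_2[OF assms(1,2)]) auto
    then show ?thesis using cut_edges_Compl[of S V] assms(3) by auto
  next
    case 3
    then show ?thesis using assms(2,3) unfolding subtour_feasible_def by blast
  qed
qed

text \<open>Every cut around a block carries weight at least 2, and its unit edges end in \<open>W\<close>.\<close>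

lemma tough_of_feasible:
  assumes "finite V" "one_two_costs V c" "subtour_feasible V x"
    and t: "subtour_objective V c x - real (card V) < real t + 1"
  shows "tough (unit_edge c) V t"
  unfolding tough_def
proof (intro allI impI, elim conjE)
  fix W \<K>
  assume W: "W \<subseteq> V" and disj: "disjoint \<K>"
    and all: "\<forall>K\<in>\<K>. K \<noteq> {} \<and> K \<subset> V \<and> K \<inter> W = {} \<and> (\<forall>x\<in>K. \<forall>y\<in>V. unit_edge c x y \<longrightarrow> y \<in> K \<union> W)"
  have K: "K \<noteq> {}" "K \<subset> V" "K \<inter> W = {}" if "K \<in> \<K>" for K using bspec[OF all that] by simp_all
  have closed: "y \<in> K \<union> W" if "K \<in> \<K>" "x \<in> K" "y \<in> V" "unit_edge c x y" for K x y
    using bspec[OF all that(1)] that(2-4) by metis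
  have "\<K> \<subseteq> Pow V" using K(2) by blast
  then have fin\<K>: "finite \<K>" using assms(1) finite_subset by blast
  have finW: "finite W" using W assms(1) finite_subset by blast
  \<comment> \<open>An edge cuts at most two blocks, which \<open>2 * (c e - 1)\<close> covers when
    the cost is 2. A unit edge leaving a block has its other end in \<open>W\<close>, outside all
    blocks; it cuts just that block and is paid for by this end.\<close>
  have count: "real (card {K \<in> \<K>. card (e \<inter> K) = 1}) \<le> real (card {w \<in> W. card (e \<inter> {w}) = 1}) + 2 * (c e - 1)"
    if e: "e \<in> complete_edges V" for e
  proof -
    obtain u v where uv: "e = {u, v}" "u \<noteq> v" "u \<in> V" "v \<in> V"
      using e unfolding complete_edges_def by (auto simp: card_2_iff)
    define cuts where "cuts = {K \<in> \<K>. card (e \<inter> K) = 1}"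
    have cutsD: "K \<in> \<K>" "u \<in> K \<longleftrightarrow> v \<notin> K" if "K \<in> cuts" for K
    proof -
      show "K \<in> \<K>" using that unfolding cuts_def by blast
      have "card (e \<inter> K) = 1" using that unfolding cuts_def by blast
      then show "u \<in> K \<longleftrightarrow> v \<notin> K" using uv by (cases "u \<in> K"; cases "v \<in> K") auto
    qed
    have fin_cuts: "finite cuts" using fin\<K> unfolding cuts_def by simp
    have unique: "card {K \<in> \<K>. z \<in> K} \<le> 1" for z
    proof -
      have "K = L" if "K \<in> {K \<in> \<K>. z \<in> K}" "L \<in> {K \<in> \<K>. z \<in> K}" for K L
        using that disjointD[OF disj, of K L] by blast
      then show ?thesis using fin\<K> by (subst card_le_Suc0_iff_eq[unfolded One_nat_def[symmetric]]) auto
    qed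
    have le2: "card cuts \<le> 2"
    proof -
      have "cuts \<subseteq> {K \<in> \<K>. u \<in> K} \<union> {K \<in> \<K>. v \<in> K}" using cutsD by blast
      then have "card cuts \<le> card ({K \<in> \<K>. u \<in> K} \<union> {K \<in> \<K>. v \<in> K})"
        using fin\<K> by (intro card_mono) auto
      also have "\<dots> \<le> card {K \<in> \<K>. u \<in> K} + card {K \<in> \<K>. v \<in> K}" by (rule card_Un_le)
      finally show ?thesis using unique[of u] unique[of v] by linarith
    qed
    have "c e = 1 \<or> c e = 2" using assms(2) e unfolding one_two_costs_def by blast
    then show ?thesis
    proof
      assume "c e = 2"
      then show ?thesis using le2 unfolding cuts_def by simp
    next
      assume c1: "c e = 1"
      have edge: "unit_edge c u v" "unit_edge c v u"
        using c1 uv(1,2) unfolding unit_edge_def by (auto simp: insert_commute)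
      have "card cuts \<le> card {w \<in> W. card (e \<inter> {w}) = 1}"
      proof (cases "cuts = {}")
        case False
        then obtain K where K': "K \<in> cuts" by blast
        obtain a b where ab: "e = {a, b}" "a \<in> K" "b \<notin> K" "a \<noteq> b" "b \<in> V" "unit_edge c a b"
          using cutsD(2)[OF K'] uv edge by (metis insert_commute)
        have KK: "K \<in> \<K>" using cutsD(1)[OF K'] .
        have bW: "b \<in> W" using closed[OF KK ab(2,5,6)] ab(3) by blast
        have "cuts \<subseteq> {L \<in> \<K>. a \<in> L}"
        proof
          fix L assume L: "L \<in> cuts"
          then have "b \<notin> L" using K(3)[OF cutsD(1)[OF L]] bW by blast
          then show "L \<in> {L \<in> \<K>. a \<in> L}" using cutsD[OF L] uv(1) ab(1) by (auto simp: doubleton_eq_iff)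
        qed
        then have "card cuts \<le> 1" using unique[of a] card_mono[of "{L \<in> \<K>. a \<in> L}" cuts] fin\<K> by simp
        moreover have "{b} \<subseteq> {w \<in> W. card (e \<inter> {w}) = 1}" using bW ab(1) by simp
        then have "card {b} \<le> card {w \<in> W. card (e \<inter> {w}) = 1}"
          using finW by (intro card_mono) auto
        then have "1 \<le> card {w \<in> W. card (e \<inter> {w}) = 1}" by simp
        ultimately show ?thesis by linarith
      qed simp
      then show ?thesis using c1 unfolding cuts_def by simp
    qed
  qed
  have x0: "0 \<le> x e" if "e \<in> complete_edges V" for e using assms(3) that unfolding subtour_feasible_def by blast
  have "2 * real (card \<K>) = (\<Sum>K\<in>\<K>. 2)" by simp
  also have "\<dots> \<le> (\<Sum>K\<in>\<K>. \<Sum>e\<in>cut_edges V K. x e)"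
    using cut_ge_2[OF assms(1,3)] K by (intro sum_mono) blast
  also have "\<dots> = (\<Sum>e\<in>complete_edges V. real (card {K \<in> \<K>. card (e \<inter> K) = 1}) * x e)"
    by (rule sum_cuts[OF assms(1) fin\<K>])
  \<comment> \<open>Weighting \<open>count\<close> by \<open>x\<close> gives degree sums over
    \<open>W\<close>, equal to \<open>2 * card W\<close>, plus twice the excess of the objective
    over \<open>card V\<close>.\<close>
  also have "\<dots> \<le> (\<Sum>e\<in>complete_edges V. (real (card {w \<in> W. card (e \<inter> {w}) = 1}) + 2 * (c e - 1)) * x e)"
    using count x0 by (intro sum_mono mult_right_mono) auto
  also have "\<dots> = (\<Sum>w\<in>W. \<Sum>e\<in>cut_edges V {w}. x e) +
      2 * (subtour_objective V c x - (\<Sum>e\<in>complete_edges V. x e))"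
    unfolding sum_cuts[OF assms(1) finW] subtour_objective_def
    by (simp add: sum.distrib[symmetric] sum_subtractf[symmetric] sum_distrib_left algebra_simps)
  also have "(\<Sum>w\<in>W. \<Sum>e\<in>cut_edges V {w}. x e) = 2 * real (card W)"
    using assms(3) W unfolding subtour_feasible_def by (simp add: subset_iff)
  also have "(\<Sum>e\<in>complete_edges V. x e) = real (card V)"
    by (rule sum_edges_eq_card[OF assms(1,3)])
  finally have "real (card \<K>) \<le> real (card W) + (subtour_objective V c x - real (card V))"
    by (simp add: algebra_simps)
  \<comment> \<open>The strict bound with \<open>t + 1\<close> turns into the desired one because
    the cardinalities are integers.\<close>
  then have "real (card \<K>) < real (card W) + real t + 1" using t by linarith
  then show "card \<K> \<le> card W + t" by linarith
qed

section \<open>The factor 5/4\<close>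

lemma card_complete_edges: "finite V \<Longrightarrow> card (complete_edges V) = card V choose 2"
  unfolding complete_edges_def by (simp add: n_subsets)

text \<open>Three nodes lie below the reach of \<open>tough_path_cover_defect\<close>. The three
  edge values are at most 1 and sum to 3, so the total slack \<open>1 - x e\<close> vanishes and the
  objective equals the cost of all three edges.\<close>

lemma min_tour_cost_triangle:
  assumes "finite V" "card V = 3" "one_two_costs V c" "subtour_feasible V x"
  shows "min_tour_cost V c \<le> subtour_objective V c x"
proof -
  note fin = finite_complete_edges[OF assms(1)]
  obtain vs where vs: "cycle_edges vs \<in> hamiltonian_cycles V" "distinct vs" "set vs = V" "3 \<le> length vs"
    using hamiltonian_cycles_nonempty[OF assms(1)] assms(2) unfolding hamiltonian_cycles_def by auto
  have "min_tour_cost V c \<le> edge_cost c (cycle_edges vs)"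
    unfolding min_tour_cost_def using finite_hamiltonian_cycles[OF assms(1)] vs(1) by (intro Min_le) auto
  also have "\<dots> \<le> (\<Sum>e\<in>complete_edges V. c e)"
    unfolding edge_cost_def using cycle_edges_subset[OF vs(2,4)] vs(3) fin cost_bounds[OF assms(3)]
    by (intro sum_mono2) force+
  also have "\<dots> \<le> (\<Sum>e\<in>complete_edges V. c e * x e + 2 * (1 - x e))"
  proof (rule sum_mono)
    fix e assume e: "e \<in> complete_edges V"
    then have "0 \<le> (2 - c e) * (1 - x e)"
      using assms(4) cost_bounds[OF assms(3) e] unfolding subtour_feasible_def by (intro mult_nonneg_nonneg) auto
    then show "c e \<le> c e * x e + 2 * (1 - x e)" by (simp add: algebra_simps)
  qed
  also have "\<dots> = subtour_objective V c x + 2 * (real (card (complete_edges V)) - (\<Sum>e\<in>complete_edges V. x e))"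
    unfolding subtour_objective_def by (simp add: sum.distrib sum_subtractf sum_distrib_left[symmetric])
  also have "\<dots> = subtour_objective V c x"
    using card_complete_edges[OF assms(1)] sum_edges_eq_card[OF assms(1,4)] assms(2) by (simp add: numeral_eq_Suc)
  finally show ?thesis .
qed

text \<open>With \<open>p\<close> paths the closing edge cancels the \<open>- 2\<close> of
  \<open>path_cover_walk\<close>, so the tour costs at most \<open>card V + p\<close>. The bound on
  \<open>p\<close> makes this at most \<open>5 / 4 * (card V + t)\<close>, where \<open>t\<close> is
  the excess of the objective rounded down.\<close>

lemma min_tour_cost_le_objective:
  assumes "finite V" "3 \<le> card V" "one_two_costs V c" "subtour_feasible V x"
  shows "min_tour_cost V c \<le> 5 / 4 * subtour_objective V c x"
proof (cases "card V = 3")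
  case True
  then show ?thesis
    using min_tour_cost_triangle[OF assms(1) True assms(3,4)] subtour_objective_ge_card[OF assms(1,3,4)] by simp
next
  case False
  define t where "t = nat \<lfloor>subtour_objective V c x - real (card V)\<rfloor>"
  have nonneg: "0 \<le> subtour_objective V c x - real (card V)"
    using subtour_objective_ge_card[OF assms(1,3,4)] by simp
  then have t: "real t \<le> subtour_objective V c x - real (card V)"
    "subtour_objective V c x - real (card V) < real t + 1"
    unfolding t_def by linarith+
  obtain p where p: "path_cover (unit_edge c) V p" "4 * p \<le> card V + 5 * t"
    using tough_path_cover_defect[OF symp_unit_edge assms(1) tough_of_feasible[OF assms(1,3,4) t(2)]]
      False assms(2) by auto
  have "V \<noteq> {}" using assms(2) by auto
  then obtain vs where vs: "distinct vs" "set vs = V" "walk_cost c vs \<le> real (card V) + real p - 2"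
    using path_cover_walk[OF p(1) assms(3)] by blast
  have "min_tour_cost V c \<le> real (card V) + real p"
    using min_tour_le_walk[OF assms(1,3,2) vs(1,2)] vs(3) by linarith
  moreover have "4 * real p \<le> real (card V) + 5 * real t" using p(2) by linarith
  ultimately show ?thesis using t(1) by linarith
qed

lemma min_tour_cost_le_subtour_value:
  assumes "finite V" "3 \<le> card V" "one_two_costs V c"
  shows "min_tour_cost V c \<le> 5 / 4 * subtour_value V c"
proof -
  have "4 / 5 * min_tour_cost V c \<le> subtour_value V c"
    unfolding subtour_value_def
  proof (rule cInf_greatest)
    show "subtour_objective V c ` {x. subtour_feasible V x} \<noteq> {}"
      using subtour_feasible_exists[OF assms(1,2)] by blast
    show "4 / 5 * min_tour_cost V c \<le> z" if "z \<in> subtour_objective V c ` {x. subtour_feasible V x}" for z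
      using that min_tour_cost_le_objective[OF assms] by fastforce
  qed
  then show ?thesis by simp
qed

theorem theorem5:
  shows "(\<forall>n (V :: 'a set) c.
            3 \<le> n \<and> finite V \<and> card V = n \<and> one_two_costs V c \<longrightarrow>
            min_tour_cost V c \<le> 19 / 15 * subtour_value V c)
         \<and> subtour_integrality_gap_12 \<le> ereal (19 / 15)"
proof (intro conjI allI impI)
  fix n c and V :: "'a set"
  assume "3 \<le> n \<and> finite V \<and> card V = n \<and> one_two_costs V c"
  \<comment> \<open>Since 5/4 is smaller than 19/15, it suffices that \<open>subtour_value\<close>
    is nonnegative, which its lower bound \<open>card V\<close> ensures.\<close>
  then show "min_tour_cost V c \<le> 19 / 15 * subtour_value V c"
    using min_tour_cost_le_subtour_value[of V c] subtour_value_ge_card[of V c] by auto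
next
  show "subtour_integrality_gap_12 \<le> ereal (19 / 15)"
    unfolding subtour_integrality_gap_12_def
  proof (rule Sup_least, elim CollectE exE conjE)
    fix r and V :: "nat set" and c
    assume r: "r = ereal (min_tour_cost V c / subtour_value V c)"
      and V: "finite V" "3 \<le> card V" "one_two_costs V c"
    have "0 < subtour_value V c" using subtour_value_ge_card[OF V] V(2) by linarith
    then have "min_tour_cost V c / subtour_value V c \<le> 19 / 15"
      using min_tour_cost_le_subtour_value[OF V] by (simp add: divide_le_eq)
    then show "r \<le> ereal (19 / 15)" using r by simp
  qed
qed

end
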